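(* Consider the linear model $\mathbf{y}=\alpha\mathbf{1}_n+\mathbf{X}\boldsymbol{\beta}+\sigma\boldsymbol{\epsilon}$, where the error vector $\boldsymbol{\epsilon}$ has a spherically symmetric density $f(\boldsymbol{\epsilon}'\boldsymbol{\epsilon})$ on $\mathbb{R}^n$ with $E[\boldsymbol{\epsilon}]=\mathbf{0}_n$ and $\mathrm{Var}[\boldsymbol{\epsilon}]=\mathbf{I}_n$, and consider Stein's loss $L_S(\delta,\sigma^2)=\delta/\sigma^2-\log(\delta/\sigma^2)-1$. Let $0<a<p$. Then the generalized Bayes estimator of $\sigma^2$ with respect to the prior $\pi(\alpha,\boldsymbol{\beta},\sigma^2)=(\boldsymbol{\beta}'\mathbf{X}'\mathbf{X}\boldsymbol{\beta})^{-(p-a)/2}\{\sigma^2\}^{-1}$ is $$\delta_a^{GB}=\phi_a^{GB}(R^2)\,\frac{\mathrm{RSS}}{n-p-1},$$ where $$\phi_a^{GB}(R^2)=\frac{n-p-1}{n-a-1}\,\frac{\int_0^1 t^{p/2-a/2-1}(1-t)^{a/2-1}(1-R^2t)^{(n-p-a-1)/2}\,dt}{\int_0^1 t^{p/2-a/2-1}(1-t)^{a/2-1}(1-R^2t)^{(n-p-a+1)/2}\,dt}.$$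
   Context: Here $\mathbf{y}\in\mathbb{R}^n$ is observed, $\alpha\in\mathbb{R}$ is an unknown intercept, $\mathbf{1}_n$ is the $n$-vector of ones, $\mathbf{X}=(\mathbf{x}_1,\dots,\mathbf{x}_p)$ is a known $n\times p$ design matrix whose columns are centered ($\mathbf{x}_i'\mathbf{1}_n=0$) and linearly independent (rank $p$), $n>p+1$, $\boldsymbol{\beta}\in\mathbb{R}^p$ is unknown, and $\sigma>0$ is unknown. With $\bar y$ the mean of the entries of $\mathbf{y}$, $\mathrm{RSS}=\|(\mathbf{I}-\mathbf{X}(\mathbf{X}'\mathbf{X})^{-1}\mathbf{X}')(\mathbf{y}-\bar y\mathbf{1}_n)\|^2$ and $R^2=\|\mathbf{X}(\mathbf{X}'\mathbf{X})^{-1}\mathbf{X}'(\mathbf{y}-\bar y\mathbf{1}_n)\|^2/\|\mathbf{y}-\bar y\mathbf{1}_n\|^2$ (the coefficient of determination). The generalized Bayes estimator under Stein's loss is $\{E[1/\sigma^2\mid\mathbf{y}]\}^{-1}$, computed with respect to the (improper) posterior from the likelihood $\sigma^{-n}f(\|\mathbf{y}-\alpha\mathbf{1}_n-\mathbf{X}\boldsymbol{\beta}\|^2/\sigma^2)$ and the given prior. *)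

theory Defs
  imports "HOL-Analysis.Analysis"
begin

definition ones :: "real ^ 'n" where
  "ones = (\<chi> i. 1)"

definition ybar :: "real ^ 'n \<Rightarrow> real" where
  "ybar y = (\<Sum>i\<in>UNIV. y $ i) / real CARD('n)"

text \<open>Orthogonal projection onto the column space of X: X (X'X)^{-1} X'.\<close>
definition hatm :: "real ^ 'p ^ 'n \<Rightarrow> real ^ 'n ^ 'n" where
  "hatm X = X ** matrix_inv (transpose X ** X) ** transpose X"

definition RSS :: "real ^ 'p ^ 'n \<Rightarrow> real ^ 'n \<Rightarrow> real" where
  "RSS X y = (norm ((mat 1 - hatm X) *v (y - ybar y *\<^sub>R ones))) ^ 2"

definition Rsq :: "real ^ 'p ^ 'n \<Rightarrow> real ^ 'n \<Rightarrow> real" where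
  "Rsq X y = (norm (hatm X *v (y - ybar y *\<^sub>R ones))) ^ 2
              / (norm (y - ybar y *\<^sub>R ones)) ^ 2"

text \<open>Generalized Bayes estimator of sigma^2 under Stein's loss,
  {E[1/sigma^2 | y]}^{-1}, where the (improper) posterior on
  theta = (alpha, beta, s) with s = sigma^2 > 0 has density proportional to
  sigma^{-n} f(||y - alpha 1 - X beta||^2 / sigma^2) * prior(alpha, beta, sigma^2)
  with respect to Lebesgue measure d alpha d beta d sigma^2.\<close>
definition likelihood ::
  "(real \<Rightarrow> real) \<Rightarrow> real ^ 'p ^ 'n \<Rightarrow> real ^ 'n \<Rightarrow> real \<times> (real ^ 'p) \<times> real \<Rightarrow> real" where
  "likelihood f X y \<theta> = (case \<theta> of (\<alpha>, \<beta>, s) \<Rightarrow>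
      s powr (- real CARD('n) / 2) * f ((norm (y - \<alpha> *\<^sub>R ones - X *v \<beta>)) ^ 2 / s))"

definition param_space :: "(real \<times> (real ^ 'p) \<times> real) set" where
  "param_space = UNIV \<times> UNIV \<times> {0<..}"

definition gb_stein ::
  "(real \<Rightarrow> real) \<Rightarrow> (real \<times> (real ^ 'p) \<times> real \<Rightarrow> real) \<Rightarrow> real ^ 'p ^ 'n \<Rightarrow> real ^ 'n \<Rightarrow> real" where
  "gb_stein f prior X y =
     inverse ((set_lebesgue_integral lborel param_space
                 (\<lambda>\<theta>. (1 / snd (snd \<theta>)) * likelihood f X y \<theta> * prior \<theta>))
            / (set_lebesgue_integral lborel param_space
                 (\<lambda>\<theta>. likelihood f X y \<theta> * prior \<theta>)))"

definition prior_a :: "real \<Rightarrow> real ^ 'p ^ 'n \<Rightarrow> real \<times> (real ^ 'p) \<times> real \<Rightarrow> real" where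
  "prior_a a X \<theta> = (case \<theta> of (\<alpha>, \<beta>, s) \<Rightarrow>
      ((norm (X *v \<beta>)) ^ 2) powr (- (real CARD('p) - a) / 2) * (1 / s))"

definition phi_GB :: "nat \<Rightarrow> nat \<Rightarrow> real \<Rightarrow> real \<Rightarrow> real" where
  "phi_GB n p a r =
     (real n - real p - 1) / (real n - a - 1) *
     ((LBINT t=0..1. t powr (real p / 2 - a / 2 - 1) * (1 - t) powr (a / 2 - 1)
                      * (1 - r * t) powr ((real n - real p - a - 1) / 2))
      / (LBINT t=0..1. t powr (real p / 2 - a / 2 - 1) * (1 - t) powr (a / 2 - 1)
                      * (1 - r * t) powr ((real n - real p - a + 1) / 2)))"

end

theory Submission
  imports Defs "HOL-Probability.Distributions"
begin

text \<open>Write Q for the squared residual norm at (alpha, beta); it splits into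
  n (alpha - ybar)^2 + RSS + norm (X (beta - b))^2, where b is the least squares estimate. Scaling
  s by Q turns the s-integral of the posterior into a constant times Q powr (- n/2 - k), with k = 1
  for the moment of 1/s and k = 0 for the normalisation, and a second scaling argument, testing
  against a Gaussian instead of using polar coordinates, shows that the two constants have ratio
  E (norm e)^2 = n. Both Q powr (- n/2 - k) and the power of norm (X beta) in the prior are Gamma
  mixtures of Gaussians, so alpha and beta integrate out after completing the square. Integrating
  the first mixing variable leaves a one-dimensional integral, which the substitution
  v = (1 - r) x / (1 - x) with r = R^2 brings into the stated Euler form. All computations are in
  nonnegative extended reals, so no integrability has to be checked.\<close>

section \<open>Substitutions in Lebesgue integrals\<close>

lemma borel_measurable_linear:
  fixes h :: "'a::euclidean_space \<Rightarrow> 'b::euclidean_space"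
  assumes "linear h"
  shows "h \<in> borel_measurable borel"
  using assms by (intro borel_measurable_continuous_onI linear_continuous_on)
    (simp add: linear_conv_bounded_linear)

lemma nn_integral_Ioi_scale:
  fixes g :: "real \<Rightarrow> ennreal"
  assumes [measurable]: "g \<in> borel_measurable borel" and c: "c > 0"
  shows "(\<integral>\<^sup>+x\<in>{0<..}. g x \<partial>lborel) = ennreal c * (\<integral>\<^sup>+x\<in>{0<..}. g (c * x) \<partial>lborel)"
  using c by (subst nn_integral_real_affine[where c = c and t = 0])
    (auto simp: indicator_def zero_less_mult_iff intro!: arg_cong2[where f = "(*)"] nn_integral_cong)

lemma nn_integral_lborel_affine:
  fixes g :: "'a::euclidean_space \<Rightarrow> ennreal"
  assumes [measurable]: "g \<in> borel_measurable borel" and c: "c > 0"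
  shows "(\<integral>\<^sup>+x. g x \<partial>lborel) = ennreal (c ^ DIM('a)) * (\<integral>\<^sup>+x. g (t + c *\<^sub>R x) \<partial>lborel)"
  using c by (subst lborel_affine[of c t])
    (simp_all add: nn_integral_density nn_integral_distr nn_integral_cmult)

text \<open>Rescaling \<open>l\<close> by \<open>Q\<close> reduces this to Euler's integral. Read
  from right to left it writes a negative power as a mixture of exponentials, which makes the
  residual factor and the prior Gaussian; read from left to right it removes a mixing variable
  again.\<close>

lemma nn_integral_Gamma:
  fixes m Q :: real
  assumes m: "m > 0" and Q: "Q > 0"
  shows "(\<integral>\<^sup>+l\<in>{0<..}. ennreal (l powr (m - 1) * exp (- (l * Q))) \<partial>lborel)
    = ennreal (Gamma m * Q powr (- m))"
proof -
  have G: "(\<integral>\<^sup>+l\<in>{0<..}. ennreal (l powr (m - 1) * exp (- l)) \<partial>lborel) = ennreal (Gamma m)"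
    unfolding Gamma_conv_nn_integral_real[OF m]
    by (intro nn_integral_cong) (auto simp: indicator_def exp_minus field_simps)
  have "ennreal (Gamma m) = ennreal Q *
      (\<integral>\<^sup>+l\<in>{0<..}. ennreal ((Q * l) powr (m - 1) * exp (- (Q * l))) \<partial>lborel)"
    unfolding G[symmetric] using Q by (subst nn_integral_Ioi_scale[of _ Q]) auto
  also have "(\<integral>\<^sup>+l\<in>{0<..}. ennreal ((Q * l) powr (m - 1) * exp (- (Q * l))) \<partial>lborel)
      = (\<integral>\<^sup>+l. ennreal (Q powr (m - 1)) *
          (ennreal (l powr (m - 1) * exp (- (l * Q))) * indicator {0<..} l) \<partial>lborel)"
    using Q by (intro nn_integral_cong)
      (auto simp: indicator_def powr_mult ennreal_mult[symmetric] mult_ac)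
  also have "\<dots> = ennreal (Q powr (m - 1)) *
      (\<integral>\<^sup>+l\<in>{0<..}. ennreal (l powr (m - 1) * exp (- (l * Q))) \<partial>lborel)"
    by (subst nn_integral_cmult) auto
  finally have *: "ennreal (Gamma m) = ennreal Q * (ennreal (Q powr (m - 1)) *
      (\<integral>\<^sup>+l\<in>{0<..}. ennreal (l powr (m - 1) * exp (- (l * Q))) \<partial>lborel))" .
  \<comment> \<open>Extended reals admit no general cancellation, so the scaled identity is
    multiplied by the reciprocal of its prefactor instead of being divided by it.\<close>
  have q: "Q powr (- m) * (Q * Q powr (m - 1)) = 1"
    using Q by (simp add: powr_diff powr_minus)
  have "ennreal (Gamma m * Q powr (- m)) = ennreal (Q powr (- m)) * ennreal (Gamma m)"
    using m Gamma_real_pos[of m] by (simp add: ennreal_mult[symmetric] mult.commute)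
  also have "\<dots> = ennreal (Q powr (- m) * (Q * Q powr (m - 1))) *
      (\<integral>\<^sup>+l\<in>{0<..}. ennreal (l powr (m - 1) * exp (- (l * Q))) \<partial>lborel)"
    unfolding * using Q by (simp add: ennreal_mult mult.assoc)
  finally show ?thesis unfolding q by simp
qed

text \<open>The odds \<open>x / (1 - x)\<close> increase from 0 to infinity on the unit interval,
  with derivative \<open>1 / (1 - x)\<^sup>2\<close>. The substitution rule is applied on compact
  intervals exhausting the domain, and both sides pass to the limit by monotone convergence.\<close>

lemma nn_integral_odds_substitution:
  fixes g :: "real \<Rightarrow> ennreal"
  assumes g[measurable]: "g \<in> borel_measurable borel"
  shows "(\<integral>\<^sup>+v\<in>{0<..}. g v \<partial>lborel)
    = (\<integral>\<^sup>+x\<in>{0<..<1}. g (x / (1 - x)) * ennreal (1 / (1 - x)\<^sup>2) \<partial>lborel)"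
proof -
  \<comment> \<open>\<open>b k\<close> is the point with odds \<open>k + 1\<close>, so the
    substitution carries \<open>{0..b k}\<close> onto \<open>{0..k + 1}\<close>.\<close>
  define b where "b k = 1 - 1 / (real k + 2)" for k
  have b: "0 < b k" "b k < 1" for k by (auto simp: b_def field_simps)
  have b_odds: "b k / (1 - b k) = real k + 1" for k by (auto simp: b_def field_simps)
  have b_mono: "b i \<le> b j" if "i \<le> j" for i j
    using that by (auto simp: b_def field_simps)
  have ex_b: "\<exists>k. x \<le> b k" if "x < 1" for x
  proof -
    obtain k where "1 / (1 - x) < real k" using reals_Archimedean2 by blast
    then have "x \<le> b k" using that by (auto simp: b_def field_simps)
    then show ?thesis ..
  qed
  have step: "(\<integral>\<^sup>+v. g v * indicator {0..real k + 1} v \<partial>lborel)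
     = (\<integral>\<^sup>+x. g (x / (1 - x)) * ennreal (1 / (1 - x)\<^sup>2) * indicator {0..b k} x \<partial>lborel)" for k
  proof -
    have "((\<lambda>x. x / (1 - x)) has_real_derivative 1 / (1 - x)\<^sup>2) (at x)" if "x \<in> {0..b k}" for x
      using that b(2)[of k]
      by (auto intro!: derivative_eq_intros simp: field_simps power2_eq_square)
    moreover have "continuous_on {0..b k} (\<lambda>x. 1 / (1 - x)\<^sup>2)"
      using b(2)[of k] by (intro continuous_intros) auto
    ultimately show ?thesis
      using nn_integral_substitution_aux[of g 0 "b k" "\<lambda>x. x / (1 - x)" "\<lambda>x. 1 / (1 - x)\<^sup>2"] b(1)[of k]
      by (simp add: b_odds)
  qed
  have sup_ind: "(SUP k. h x * indicator (A k) x) = h x * indicator (\<Union>k. A k) x"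
    for h :: "real \<Rightarrow> ennreal" and A :: "nat \<Rightarrow> real set" and x
  proof (cases "x \<in> (\<Union>k. A k)")
    case True
    then obtain k where k: "x \<in> A k" by auto
    have "(SUP k. h x * indicator (A k) x) = h x"
    proof (rule antisym)
      show "(SUP k. h x * indicator (A k) x) \<le> h x"
        by (intro SUP_least) (auto simp: indicator_def)
      show "h x \<le> (SUP k. h x * indicator (A k) x)"
        by (rule SUP_upper2[of k]) (auto simp: k)
    qed
    with True show ?thesis by simp
  qed (auto simp: indicator_def)
  have "\<exists>k. v \<le> real k + 1" for v
    by (meson add_increasing2 real_arch_simple zero_le_one)
  then have U1: "(\<Union>k. {0..real k + 1}) = {0..}"
    by (intro equalityI subsetI) auto
  have U2: "(\<Union>k. {0..b k}) = {0..<1}"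
    using b(2) ex_b by (intro equalityI subsetI) (auto intro: le_less_trans)
  \<comment> \<open>The compact intervals contain the endpoint 0; being a null set, it can be added
    here and removed again at the end.\<close>
  have "(\<integral>\<^sup>+v\<in>{0<..}. g v \<partial>lborel) = (\<integral>\<^sup>+v\<in>{0..}. g v \<partial>lborel)"
    by (intro nn_integral_cong_AE) (use AE_lborel_singleton[of 0] in eventually_elim, auto simp: indicator_def)
  also have "\<dots> = (\<integral>\<^sup>+v. (SUP k. g v * indicator {0..real k + 1} v) \<partial>lborel)"
    by (subst sup_ind) (simp add: U1)
  also have "\<dots> = (SUP k. \<integral>\<^sup>+v. g v * indicator {0..real k + 1} v \<partial>lborel)"
    by (rule nn_integral_monotone_convergence_SUP)
       (auto simp: incseq_def le_fun_def indicator_def)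
  also have "\<dots> = (SUP k. \<integral>\<^sup>+x. g (x / (1 - x)) * ennreal (1 / (1 - x)\<^sup>2) * indicator {0..b k} x \<partial>lborel)"
    by (simp only: step)
  also have "\<dots> = (\<integral>\<^sup>+x. (SUP k. g (x / (1 - x)) * ennreal (1 / (1 - x)\<^sup>2) * indicator {0..b k} x) \<partial>lborel)"
    by (rule nn_integral_monotone_convergence_SUP[symmetric])
       (auto simp: incseq_def le_fun_def indicator_def intro: order_trans b_mono)
  also have "\<dots> = (\<integral>\<^sup>+x\<in>{0..<1}. g (x / (1 - x)) * ennreal (1 / (1 - x)\<^sup>2) \<partial>lborel)"
    by (subst sup_ind) (simp add: U2)
  also have "\<dots> = (\<integral>\<^sup>+x\<in>{0<..<1}. g (x / (1 - x)) * ennreal (1 / (1 - x)\<^sup>2) \<partial>lborel)"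
    by (intro nn_integral_cong_AE) (use AE_lborel_singleton[of 0] in eventually_elim, auto simp: indicator_def)
  finally show ?thesis .
qed

text \<open>Replacing \<open>s\<close> by \<open>Q * s\<close> contributes \<open>Q\<close> from the
  measure and \<open>Q powr (- m - 1)\<close> from the weight, and frees the argument of
  \<open>f\<close> from \<open>Q\<close>. The error density therefore enters the posterior only
  through a constant.\<close>

lemma nn_integral_inverse_scale_mixture:
  fixes f :: "real \<Rightarrow> real"
  assumes [measurable]: "f \<in> borel_measurable borel" and Q: "Q > 0"
  shows "(\<integral>\<^sup>+s\<in>{0<..}. ennreal (s powr (- m - 1) * f (Q / s)) \<partial>lborel)
    = ennreal (Q powr (- m)) * (\<integral>\<^sup>+s\<in>{0<..}. ennreal (s powr (- m - 1) * f (1 / s)) \<partial>lborel)"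
proof -
  have "(\<integral>\<^sup>+s\<in>{0<..}. ennreal (s powr (- m - 1) * f (Q / s)) \<partial>lborel)
     = ennreal Q * (\<integral>\<^sup>+s\<in>{0<..}. ennreal ((Q * s) powr (- m - 1) * f (Q / (Q * s))) \<partial>lborel)"
    using Q by (subst nn_integral_Ioi_scale[of _ Q]) auto
  also have "(\<integral>\<^sup>+s\<in>{0<..}. ennreal ((Q * s) powr (- m - 1) * f (Q / (Q * s))) \<partial>lborel)
     = (\<integral>\<^sup>+s. ennreal (Q powr (- m - 1)) * (ennreal (s powr (- m - 1) * f (1 / s)) * indicator {0<..} s) \<partial>lborel)"
    using Q by (intro nn_integral_cong)
      (auto simp: indicator_def powr_mult ennreal_mult'[symmetric] mult_ac)
  also have "\<dots> = ennreal (Q powr (- m - 1)) * (\<integral>\<^sup>+s\<in>{0<..}. ennreal (s powr (- m - 1) * f (1 / s)) \<partial>lborel)"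
    by (subst nn_integral_cmult) auto
  finally show ?thesis
    using Q by (simp add: mult.assoc[symmetric] ennreal_mult[symmetric] powr_diff)
qed

section \<open>Gaussian integrals and Gamma mixtures\<close>

lemma nn_integral_exp_square:
  fixes c :: real
  assumes "c > 0"
  shows "(\<integral>\<^sup>+x. ennreal (exp (- (c * x)\<^sup>2)) \<partial>lborel) < \<infinity>"
proof -
  \<comment> \<open>The standard deviation with \<open>2 * \<sigma>\<^sup>2 = 1 / c\<^sup>2\<close>,
    which gives the normal density the exponent \<open>- (c * x)\<^sup>2\<close>.\<close>
  define \<sigma> where "\<sigma> = 1 / (c * sqrt 2)"
  have \<sigma>: "\<sigma> > 0" using assms by (simp add: \<sigma>_def)
  have "(\<lambda>x. sqrt (2 * pi * \<sigma>\<^sup>2) * normal_density 0 \<sigma> x) = (\<lambda>x. exp (- (c * x)\<^sup>2))"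
    using \<sigma> assms by (auto simp: normal_density_def \<sigma>_def fun_eq_iff power_mult_distrib power_divide field_simps)
  moreover have "integrable lborel (\<lambda>x. sqrt (2 * pi * \<sigma>\<^sup>2) * normal_density 0 \<sigma> x)"
    using \<sigma> by (intro integrable_mult_right) simp
  ultimately have "integrable lborel (\<lambda>x. exp (- (c * x)\<^sup>2))" by simp
  then show ?thesis
    by (simp add: integrable_iff_bounded)
qed

text \<open>An injective linear map is bounded below by a multiple of the norm, so the integrand is
  dominated by a product of one-dimensional Gaussians; it vanishes nowhere, so the integral is not
  0. The value itself is never computed, because it cancels in the final quotient.\<close>

lemma nn_integral_exp_linear_square:
  fixes h :: "'a::euclidean_space \<Rightarrow> 'b::euclidean_space"
  assumes h: "linear h" "inj h"
  shows "(\<integral>\<^sup>+x. ennreal (exp (- (norm (h x))\<^sup>2)) \<partial>lborel) \<in> {0<..<\<infinity>}"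
proof -
  obtain c where c: "c > 0" "\<And>x. c * norm x \<le> norm (h x)"
    using linear_inj_bounded_below_pos[OF h] by blast
  have [measurable]: "h \<in> borel_measurable borel"
    using h(1) by (rule borel_measurable_linear)
  have "(\<integral>\<^sup>+x. ennreal (exp (- (norm (h x))\<^sup>2)) \<partial>lborel) \<le>
     (\<integral>\<^sup>+x. (\<Prod>b\<in>Basis. ennreal (exp (- (c * ((x::'a) \<bullet> b))\<^sup>2))) \<partial>lborel)"
  proof (intro nn_integral_mono)
    fix x :: 'a
    have "(\<Sum>b\<in>Basis. (c * (x \<bullet> b))\<^sup>2) = (c * norm x)\<^sup>2"
      unfolding power_mult_distrib power2_norm_eq_inner euclidean_inner[of x x]
      by (simp add: power2_eq_square sum_distrib_left)
    also have "\<dots> \<le> (norm (h x))\<^sup>2"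
      using c by (intro power_mono) auto
    finally show "ennreal (exp (- (norm (h x))\<^sup>2)) \<le> (\<Prod>b\<in>Basis. ennreal (exp (- (c * (x \<bullet> b))\<^sup>2)))"
      by (simp add: prod_ennreal exp_sum[symmetric] sum_negf)
  qed
  also have "\<dots> = (\<Prod>b\<in>(Basis::'a set). \<integral>\<^sup>+x. ennreal (exp (- (c * x)\<^sup>2)) \<partial>lborel)"
    by (intro nn_integral_lborel_prod) auto
  also have "\<dots> < \<infinity>"
    using nn_integral_exp_square[OF c(1)] by (simp add: power_less_top_ennreal)
  finally have "(\<integral>\<^sup>+x. ennreal (exp (- (norm (h x))\<^sup>2)) \<partial>lborel) < \<infinity>" .
  moreover have "(\<integral>\<^sup>+x. ennreal (exp (- (norm (h x))\<^sup>2)) \<partial>lborel) \<noteq> 0"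
    by (subst nn_integral_0_iff_AE) (auto simp: ennreal_eq_0_iff not_le eventually_False ae_filter_eq_bot_iff)
  ultimately show ?thesis by (simp add: zero_less_iff_neq_zero)
qed

text \<open>Both sides evaluate one double integral over \<open>s\<close> and \<open>e\<close>, in
  the two orders of integration, with a Gaussian test factor taking the place of polar coordinates.
  For \<open>\<kappa>\<close> equal to 0 and 1 the integral on the right is the total mass and the
  second moment of the error, which fixes the ratio of the two constants left by the
  \<open>s\<close>-integration.\<close>

lemma radial_moment:
  fixes f :: "real \<Rightarrow> real" and \<kappa> :: real
  assumes f[measurable]: "f \<in> borel_measurable borel" and f_nonneg: "\<And>t. t \<ge> 0 \<Longrightarrow> f t \<ge> 0"
  defines "D \<equiv> real DIM('a::euclidean_space)"
  shows "(\<integral>\<^sup>+s\<in>{0<..}. ennreal (s powr (- (D / 2 + \<kappa>) - 1) * f (1 / s)) \<partial>lborel)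
      * (\<integral>\<^sup>+e. ennreal (exp (- (norm (e::'a))\<^sup>2)) \<partial>lborel)
    = ennreal (Gamma (D / 2)) * (\<integral>\<^sup>+e. ennreal (((norm (e::'a))\<^sup>2) powr \<kappa> * f ((norm e)\<^sup>2)) \<partial>lborel)"
    (is "?C * ?G = _")
proof -
  define m where "m = D / 2 + \<kappa>"
  \<comment> \<open>The test factor is chosen so that \<open>u powr (- m) * H u = exp (- u)\<close>
    for positive \<open>u\<close>: the power produced by the scaling in \<open>s\<close> is
    cancelled and a Gaussian remains.\<close>
  define H where "H u = u powr m * exp (- u)" for u :: real
  have [measurable]: "H \<in> borel_measurable borel" unfolding H_def by measurable
  have D: "D > 0" by (simp add: D_def)
  have "?C * ?G = (\<integral>\<^sup>+e. ?C * ennreal (exp (- (norm (e::'a))\<^sup>2)) \<partial>lborel)"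
    by (subst nn_integral_cmult) auto
  \<comment> \<open>Scaling requires a positive squared norm, which excludes only the origin, a null
    set.\<close>
  also have "\<dots> = (\<integral>\<^sup>+e. (\<integral>\<^sup>+s\<in>{0<..}. ennreal (s powr (- m - 1) * f ((norm (e::'a))\<^sup>2 / s)) \<partial>lborel)
      * ennreal (H ((norm e)\<^sup>2)) \<partial>lborel)"
  proof (rule nn_integral_cong_AE, use AE_lborel_singleton[of 0] in eventually_elim)
    fix e :: 'a assume "e \<noteq> 0"
    then show "?C * ennreal (exp (- (norm e)\<^sup>2)) =
      (\<integral>\<^sup>+s\<in>{0<..}. ennreal (s powr (- m - 1) * f ((norm e)\<^sup>2 / s)) \<partial>lborel) * ennreal (H ((norm e)\<^sup>2))"
      by (subst nn_integral_inverse_scale_mixture)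
        (simp_all add: H_def ennreal_mult mult_ac m_def[symmetric] powr_minus,
         simp add: mult.assoc[symmetric] ennreal_mult[symmetric])
  qed
  also have "\<dots> = (\<integral>\<^sup>+e. \<integral>\<^sup>+s. ennreal (s powr (- m - 1) * f ((norm (e::'a))\<^sup>2 / s) * H ((norm e)\<^sup>2)) * indicator {0<..} s \<partial>lborel \<partial>lborel)"
    by (intro nn_integral_cong, subst nn_integral_multc[symmetric])
       (auto simp: indicator_def H_def f_nonneg ennreal_mult intro!: nn_integral_cong)
  also have "\<dots> = (\<integral>\<^sup>+s. \<integral>\<^sup>+e. ennreal (s powr (- m - 1) * f ((norm (e::'a))\<^sup>2 / s) * H ((norm e)\<^sup>2)) * indicator {0<..} s \<partial>lborel \<partial>lborel)"
    by (rule lborel_pair.Fubini') measurable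
  \<comment> \<open>For fixed \<open>s\<close> the substitution
    \<open>e = sqrt s *\<^sub>R z\<close>, with Jacobian \<open>s powr (D / 2)\<close>, removes
    \<open>s\<close> from the argument of \<open>f\<close>.\<close>
  also have "\<dots> = (\<integral>\<^sup>+s. \<integral>\<^sup>+z. ennreal (s powr (D / 2 - 1) * exp (- (s * (norm (z::'a))\<^sup>2))
      * (((norm z)\<^sup>2) powr m * f ((norm z)\<^sup>2))) * indicator {0<..} s \<partial>lborel \<partial>lborel)"
  proof (rule nn_integral_cong)
    fix s :: real
    show "(\<integral>\<^sup>+e. ennreal (s powr (- m - 1) * f ((norm (e::'a))\<^sup>2 / s) * H ((norm e)\<^sup>2)) * indicator {0<..} s \<partial>lborel)
      = (\<integral>\<^sup>+z. ennreal (s powr (D / 2 - 1) * exp (- (s * (norm (z::'a))\<^sup>2))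
      * (((norm z)\<^sup>2) powr m * f ((norm z)\<^sup>2))) * indicator {0<..} s \<partial>lborel)"
    proof (cases "s > 0")
      case True
      have c: "sqrt s ^ DIM('a) = s powr (D / 2)"
        using True by (simp add: powr_half_sqrt[symmetric] powr_realpow[symmetric] powr_powr D_def)
      have "(\<integral>\<^sup>+e. ennreal (s powr (- m - 1) * f ((norm (e::'a))\<^sup>2 / s) * H ((norm e)\<^sup>2)) \<partial>lborel)
        = ennreal (s powr (D / 2)) * (\<integral>\<^sup>+z. ennreal (s powr (- m - 1) * f ((norm (0 + sqrt s *\<^sub>R z::'a))\<^sup>2 / s)
            * H ((norm (0 + sqrt s *\<^sub>R z))\<^sup>2)) \<partial>lborel)"
        using True unfolding c[symmetric] by (intro nn_integral_lborel_affine) auto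
      also have "\<dots> = (\<integral>\<^sup>+z. ennreal (s powr (D / 2)) * ennreal (s powr (- m - 1) * f ((norm (z::'a))\<^sup>2)
            * H (s * (norm z)\<^sup>2)) \<partial>lborel)"
        using True by (subst nn_integral_cmult[symmetric]) (simp_all add: power_mult_distrib)
      also have "\<dots> = (\<integral>\<^sup>+z. ennreal (s powr (D / 2 - 1) * exp (- (s * (norm (z::'a))\<^sup>2))
        * (((norm z)\<^sup>2) powr m * f ((norm z)\<^sup>2))) \<partial>lborel)"
      proof (intro nn_integral_cong)
        fix z :: 'a
        \<comment> \<open>The exponents come from the Jacobian, the mixing weight and the power
          inside \<open>H\<close>.\<close>
        have p: "s powr (D / 2 - 1) = s powr (D / 2) * (s powr (- m - 1) * s powr m)"
          unfolding powr_add[symmetric] by (rule arg_cong) simp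
        show "ennreal (s powr (D / 2)) * ennreal (s powr (- m - 1) * f ((norm z)\<^sup>2) * H (s * (norm z)\<^sup>2))
          = ennreal (s powr (D / 2 - 1) * exp (- (s * (norm z)\<^sup>2)) * (((norm z)\<^sup>2) powr m * f ((norm z)\<^sup>2)))"
          unfolding p using True by (simp add: ennreal_mult'[symmetric] H_def powr_mult mult_ac)
      qed
      finally show ?thesis using True by simp
    qed simp
  qed
  also have "\<dots> = (\<integral>\<^sup>+z. \<integral>\<^sup>+s. ennreal (s powr (D / 2 - 1) * exp (- (s * (norm (z::'a))\<^sup>2))
      * (((norm z)\<^sup>2) powr m * f ((norm z)\<^sup>2))) * indicator {0<..} s \<partial>lborel \<partial>lborel)"
    by (rule lborel_pair.Fubini') measurable
  also have "\<dots> = (\<integral>\<^sup>+z. (\<integral>\<^sup>+s\<in>{0<..}. ennreal (s powr (D / 2 - 1) * exp (- (s * (norm (z::'a))\<^sup>2))) \<partial>lborel)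
      * ennreal (((norm z)\<^sup>2) powr m * f ((norm z)\<^sup>2)) \<partial>lborel)"
    by (intro nn_integral_cong, subst nn_integral_multc[symmetric])
       (auto simp: indicator_def f_nonneg ennreal_mult intro!: nn_integral_cong)
  \<comment> \<open>The Gamma integral over \<open>s\<close> yields the squared norm to the power
    \<open>- D / 2\<close>, which leaves exactly the exponent \<open>\<kappa>\<close> of
    \<open>m = D / 2 + \<kappa>\<close>.\<close>
  also have "\<dots> = (\<integral>\<^sup>+z. ennreal (Gamma (D / 2)) * ennreal (((norm (z::'a))\<^sup>2) powr \<kappa> * f ((norm z)\<^sup>2)) \<partial>lborel)"
  proof (rule nn_integral_cong_AE, use AE_lborel_singleton[of 0] in eventually_elim)
    fix z :: 'a assume "z \<noteq> 0"
    have p: "((norm z)\<^sup>2) powr m = ((norm z)\<^sup>2) powr (D / 2) * ((norm z)\<^sup>2) powr \<kappa>"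
      by (simp add: m_def powr_add)
    show "(\<integral>\<^sup>+s\<in>{0<..}. ennreal (s powr (D / 2 - 1) * exp (- (s * (norm (z::'a))\<^sup>2))) \<partial>lborel)
      * ennreal (((norm z)\<^sup>2) powr m * f ((norm z)\<^sup>2))
      = ennreal (Gamma (D / 2)) * ennreal (((norm z)\<^sup>2) powr \<kappa> * f ((norm z)\<^sup>2))"
      unfolding p using D Gamma_real_pos[of "D / 2"] \<open>z \<noteq> 0\<close>
      by (subst nn_integral_Gamma)
        (simp_all add: ennreal_mult[symmetric] f_nonneg powr_minus field_simps)
  qed
  also have "\<dots> = ennreal (Gamma (D / 2)) * (\<integral>\<^sup>+e. ennreal (((norm (e::'a))\<^sup>2) powr \<kappa> * f ((norm e)\<^sup>2)) \<partial>lborel)"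
    by (subst nn_integral_cmult) auto
  finally show ?thesis .
qed

section \<open>Integrating out the location parameters and the mixing variables\<close>

lemma complete_square:
  fixes u w :: "'a::real_inner"
  assumes "l + t > 0"
  shows "l * (norm (u - w))\<^sup>2 + t * (norm u)\<^sup>2
    = (l + t) * (norm (u - (l / (l + t)) *\<^sub>R w))\<^sup>2 + l * t / (l + t) * (norm w)\<^sup>2"
proof -
  have n: "(norm (u - c *\<^sub>R w))\<^sup>2 = (norm u)\<^sup>2 - 2 * c * (u \<bullet> w) + c\<^sup>2 * (norm w)\<^sup>2" for c
    unfolding power2_norm_eq_inner
    by (simp add: inner_diff_left inner_diff_right inner_commute power2_eq_square)
  show ?thesis
    unfolding n[of 1, simplified] n[of "l / (l + t)"]
    using assms by (simp add: divide_simps) (simp add: power2_eq_square algebra_simps)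
qed

text \<open>By linearity the exponent is a quadratic in \<open>h x\<close>; completing the square
  centres it at \<open>l / (l + t)\<close> times \<open>b\<close>, and an affine change of variable
  gives it unit precision. The case \<open>t = 0\<close> is a plain shifted Gaussian.\<close>

lemma nn_integral_gaussian_tilted:
  fixes h :: "'a::euclidean_space \<Rightarrow> 'b::euclidean_space"
  assumes h: "linear h" and l: "l > 0" and t: "t \<ge> 0"
  shows "(\<integral>\<^sup>+x. ennreal (exp (- (l * (norm (h (x - b)))\<^sup>2 + t * (norm (h x))\<^sup>2))) \<partial>lborel)
    = ennreal ((l + t) powr (- real DIM('a) / 2) * exp (- (l * t / (l + t) * (norm (h b))\<^sup>2)))
      * (\<integral>\<^sup>+x. ennreal (exp (- (norm (h x))\<^sup>2)) \<partial>lborel)"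
proof -
  have [measurable]: "h \<in> borel_measurable borel"
    using h(1) by (rule borel_measurable_linear)
  \<comment> \<open>The scale that turns precision \<open>l + t\<close> into 1; its Jacobian is the
    power of \<open>l + t\<close> in the claim.\<close>
  define c where "c = (l + t) powr (- 1 / 2)"
  have c: "c > 0" "c ^ DIM('a) = (l + t) powr (- real DIM('a) / 2)"
    using l t by (simp_all add: c_def powr_realpow[symmetric] powr_powr)
  have c2: "(l + t) * c\<^sup>2 = 1"
    using l t by (simp add: c_def powr_powr powr_realpow[symmetric] powr_minus field_simps)
  have lt: "l + t > 0" using l t by simp
  have "(\<integral>\<^sup>+x. ennreal (exp (- (l * (norm (h (x - b)))\<^sup>2 + t * (norm (h x))\<^sup>2))) \<partial>lborel)
    = ennreal ((l + t) powr (- real DIM('a) / 2)) * (\<integral>\<^sup>+x. ennreal (exp (-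
       (l * (norm (h (((l / (l + t)) *\<^sub>R b + c *\<^sub>R x) - b)))\<^sup>2 + t * (norm (h ((l / (l + t)) *\<^sub>R b + c *\<^sub>R x)))\<^sup>2))) \<partial>lborel)"
    unfolding c(2)[symmetric] using c(1) by (intro nn_integral_lborel_affine) auto
  also have "(\<lambda>x. l * (norm (h (((l / (l + t)) *\<^sub>R b + c *\<^sub>R x) - b)))\<^sup>2 + t * (norm (h ((l / (l + t)) *\<^sub>R b + c *\<^sub>R x)))\<^sup>2)
    = (\<lambda>x. (norm (h x))\<^sup>2 + l * t / (l + t) * (norm (h b))\<^sup>2)"
    unfolding linear_diff[OF h] complete_square[OF lt] using c2
    by (simp add: linear_add[OF h] linear_scale[OF h] power_mult_distrib mult.assoc[symmetric])
  also have "(\<integral>\<^sup>+x. ennreal (exp (- ((norm (h x))\<^sup>2 + l * t / (l + t) * (norm (h b))\<^sup>2))) \<partial>lborel)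
    = ennreal (exp (- (l * t / (l + t) * (norm (h b))\<^sup>2))) * (\<integral>\<^sup>+x. ennreal (exp (- (norm (h x))\<^sup>2)) \<partial>lborel)"
    by (subst nn_integral_cmult[symmetric])
       (auto simp: ennreal_mult[symmetric] exp_add[symmetric] add.commute)
  finally show ?thesis by (simp add: ennreal_mult mult.assoc)
qed

text \<open>The power of the squared norm becomes a Gamma mixture over a second precision
  \<open>t\<close>, after which the \<open>x\<close>-integral is a tilted Gaussian. Substituting
  \<open>t = l * v\<close> leaves \<open>l\<close> only in a power and linearly in an exponent,
  ready for a later Gamma integral over \<open>l\<close>.\<close>

lemma nn_integral_gaussian_power:
  fixes h :: "'a::euclidean_space \<Rightarrow> 'b::euclidean_space"
  assumes h: "linear h" "inj h" and l: "l > 0" and d: "d > 0"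
  defines "D \<equiv> real DIM('a)"
  shows "ennreal (Gamma d) * (\<integral>\<^sup>+x. ennreal (exp (- (l * (norm (h (x - b)))\<^sup>2)) * ((norm (h x))\<^sup>2) powr (- d)) \<partial>lborel)
    = ennreal (l powr (d - D / 2)) * (\<integral>\<^sup>+x. ennreal (exp (- (norm (h x))\<^sup>2)) \<partial>lborel) *
      (\<integral>\<^sup>+v\<in>{0<..}. ennreal (v powr (d - 1) * (1 + v) powr (- D / 2)
          * exp (- (l * (v / (1 + v) * (norm (h b))\<^sup>2)))) \<partial>lborel)"
    (is "_ * ?I = _ * ?K * ?V")
proof -
  have [measurable]: "h \<in> borel_measurable borel"
    using h(1) by (rule borel_measurable_linear)
  \<comment> \<open>Injectivity confines the zero of the norm to the origin, so the Gamma
    representation holds almost everywhere.\<close>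
  have h0: "h x \<noteq> 0" if "x \<noteq> 0" for x
    using h that by (metis injD linear_0)
  have "ennreal (Gamma d) * ?I = (\<integral>\<^sup>+x. ennreal (Gamma d) * ennreal (exp (- (l * (norm (h (x - b)))\<^sup>2)) * ((norm (h x))\<^sup>2) powr (- d)) \<partial>lborel)"
    by (subst nn_integral_cmult) auto
  also have "\<dots> = (\<integral>\<^sup>+x. ennreal (exp (- (l * (norm (h (x - b)))\<^sup>2))) *
      (\<integral>\<^sup>+t\<in>{0<..}. ennreal (t powr (d - 1) * exp (- (t * (norm (h x))\<^sup>2))) \<partial>lborel) \<partial>lborel)"
  proof (rule nn_integral_cong_AE, use AE_lborel_singleton[of 0] in eventually_elim)
    fix x :: 'a assume "x \<noteq> 0"
    then show "ennreal (Gamma d) * ennreal (exp (- (l * (norm (h (x - b)))\<^sup>2)) * ((norm (h x))\<^sup>2) powr (- d)) =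
      ennreal (exp (- (l * (norm (h (x - b)))\<^sup>2))) *
      (\<integral>\<^sup>+t\<in>{0<..}. ennreal (t powr (d - 1) * exp (- (t * (norm (h x))\<^sup>2))) \<partial>lborel)"
      using d h0[of x] Gamma_real_pos[of d]
      by (subst nn_integral_Gamma) (simp_all add: ennreal_mult[symmetric] mult_ac)
  qed
  also have "\<dots> = (\<integral>\<^sup>+x. \<integral>\<^sup>+t. ennreal (t powr (d - 1) * exp (- (l * (norm (h (x - b)))\<^sup>2 + t * (norm (h x))\<^sup>2)))
      * indicator {0<..} t \<partial>lborel \<partial>lborel)"
    by (intro nn_integral_cong, subst nn_integral_cmult[symmetric])
       (auto simp: indicator_def ennreal_mult[symmetric] exp_diff exp_minus field_simps intro!: nn_integral_cong)
  also have "\<dots> = (\<integral>\<^sup>+t. \<integral>\<^sup>+x. ennreal (t powr (d - 1) * exp (- (l * (norm (h (x - b)))\<^sup>2 + t * (norm (h x))\<^sup>2)))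
      * indicator {0<..} t \<partial>lborel \<partial>lborel)"
    by (rule lborel_pair.Fubini') measurable
  also have "\<dots> = (\<integral>\<^sup>+t\<in>{0<..}. ?K * ennreal (t powr (d - 1) * (l + t) powr (- D / 2)
      * exp (- (l * t / (l + t) * (norm (h b))\<^sup>2))) \<partial>lborel)"
  proof (rule nn_integral_cong)
    fix t :: real
    show "(\<integral>\<^sup>+x. ennreal (t powr (d - 1) * exp (- (l * (norm (h (x - b)))\<^sup>2 + t * (norm (h x))\<^sup>2)))
      * indicator {0<..} t \<partial>lborel) = ?K * ennreal (t powr (d - 1) * (l + t) powr (- D / 2)
      * exp (- (l * t / (l + t) * (norm (h b))\<^sup>2))) * indicator {0<..} t"
    proof (cases "t > 0")
      case True
      then have "(\<integral>\<^sup>+x. ennreal (t powr (d - 1) * exp (- (l * (norm (h (x - b)))\<^sup>2 + t * (norm (h x))\<^sup>2))) \<partial>lborel)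
        = ennreal (t powr (d - 1)) * (\<integral>\<^sup>+x. ennreal (exp (- (l * (norm (h (x - b)))\<^sup>2 + t * (norm (h x))\<^sup>2))) \<partial>lborel)"
        by (subst nn_integral_cmult[symmetric]) (simp_all add: ennreal_mult)
      also have "\<dots> = ?K * ennreal (t powr (d - 1) * (l + t) powr (- D / 2)
          * exp (- (l * t / (l + t) * (norm (h b))\<^sup>2)))"
        using True l h by (subst nn_integral_gaussian_tilted) (simp_all add: ennreal_mult D_def mult_ac)
      finally show ?thesis using True by simp
    qed simp
  qed
  \<comment> \<open>With \<open>t = l * v\<close> the shrunken precision
    \<open>l * t / (l + t)\<close> equals \<open>l * (v / (1 + v))\<close>.\<close>
  also have "\<dots> = ennreal l * (\<integral>\<^sup>+v\<in>{0<..}. ?K * ennreal ((l * v) powr (d - 1) * (l + l * v) powr (- D / 2)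
      * exp (- (l * (l * v) / (l + l * v) * (norm (h b))\<^sup>2))) \<partial>lborel)"
    using l by (subst nn_integral_Ioi_scale[of _ l]) auto
  also have "\<dots> = ennreal l * (\<integral>\<^sup>+v. (ennreal (l powr (d - D / 2 - 1)) * ?K) * (ennreal (v powr (d - 1) * (1 + v) powr (- D / 2)
          * exp (- (l * (v / (1 + v) * (norm (h b))\<^sup>2)))) * indicator {0<..} v) \<partial>lborel)"
  proof (rule arg_cong[where f = "(*) (ennreal l)"], rule nn_integral_cong)
    fix v :: real
    show "?K * ennreal ((l * v) powr (d - 1) * (l + l * v) powr (- D / 2)
      * exp (- (l * (l * v) / (l + l * v) * (norm (h b))\<^sup>2))) * indicator {0<..} v
      = (ennreal (l powr (d - D / 2 - 1)) * ?K) * (ennreal (v powr (d - 1) * (1 + v) powr (- D / 2)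
          * exp (- (l * (v / (1 + v) * (norm (h b))\<^sup>2)))) * indicator {0<..} v)"
    proof (cases "v > 0")
      case True
      have e: "l + l * v = l * (1 + v)" by (simp add: algebra_simps)
      have p: "l powr (d - D / 2 - 1) = l powr (d - 1) * l powr (- D / 2)"
        using l by (simp add: powr_add[symmetric] algebra_simps)
      have q: "l * (l * v) / (l * (1 + v)) * (norm (h b))\<^sup>2 = l * (v / (1 + v) * (norm (h b))\<^sup>2)"
        using l by simp
      have "(l * v) powr (d - 1) * (l + l * v) powr (- D / 2) * exp (- (l * (l * v) / (l + l * v) * (norm (h b))\<^sup>2))
        = l powr (d - D / 2 - 1) * (v powr (d - 1) * (1 + v) powr (- D / 2) * exp (- (l * (v / (1 + v) * (norm (h b))\<^sup>2))))"
        unfolding e p q using l True by (simp add: powr_mult mult_ac)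
      then show ?thesis using True by (simp add: ennreal_mult mult_ac)
    qed simp
  qed
  also have "\<dots> = ennreal l * (ennreal (l powr (d - D / 2 - 1)) * ?K * ?V)"
    by (subst nn_integral_cmult) auto
  also have "\<dots> = ennreal (l * l powr (d - D / 2 - 1)) * ?K * ?V"
    using l by (simp add: ennreal_mult mult.assoc)
  also have "l * l powr (d - D / 2 - 1) = l powr (d - D / 2)"
    using l by (simp add: powr_diff)
  finally show ?thesis .
qed

text \<open>Writing the power \<open>- m\<close> of the three-term sum as a Gamma mixture over
  \<open>l\<close> makes the exponential factorise over \<open>z\<close> and \<open>x\<close>. The
  \<open>z\<close>-integral contributes \<open>- DIM('c) / 2\<close> and the
  \<open>x\<close>-integral \<open>d - D / 2\<close> to the exponent of \<open>l\<close>; together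
  with \<open>m\<close> these add up to \<open>q\<close>, and the \<open>l\<close>-integral gives
  the power \<open>- q\<close>.\<close>

lemma nn_integral_two_gaussian_power:
  fixes g :: "'c::euclidean_space \<Rightarrow> 'd::euclidean_space" and h :: "'a::euclidean_space \<Rightarrow> 'b::euclidean_space"
  assumes g: "linear g" and h: "linear h" "inj h"
    and d: "d > 0" and m: "m > 0" and S: "S > 0"
  defines "D \<equiv> real DIM('a)"
  defines "q \<equiv> m - real DIM('c) / 2 + d - D / 2"
  assumes q: "q > 0"
  shows "ennreal (Gamma m * Gamma d) * (\<integral>\<^sup>+z. \<integral>\<^sup>+x. ennreal (
        ((norm (g (z - c)))\<^sup>2 + S + (norm (h (x - b)))\<^sup>2) powr (- m) * ((norm (h x))\<^sup>2) powr (- d)) \<partial>lborel \<partial>lborel)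
    = (\<integral>\<^sup>+z. ennreal (exp (- (norm (g z))\<^sup>2)) \<partial>lborel) * (\<integral>\<^sup>+x. ennreal (exp (- (norm (h x))\<^sup>2)) \<partial>lborel)
      * ennreal (Gamma q) * (\<integral>\<^sup>+v\<in>{0<..}. ennreal (v powr (d - 1) * (1 + v) powr (- D / 2)
          * (S + v / (1 + v) * (norm (h b))\<^sup>2) powr (- q)) \<partial>lborel)"
    (is "_ = ?A * ?K * _ * _")
proof -
  have [measurable]: "h \<in> borel_measurable borel" "g \<in> borel_measurable borel"
    using g h by (auto intro: borel_measurable_linear)
  \<comment> \<open>For fixed \<open>l\<close>, \<open>F\<close> is the \<open>x\<close>-factor
    including the singular power, \<open>E\<close> the \<open>z\<close>-factor, and \<open>B\<close>
    the mixing weight together with the contribution of \<open>S\<close>.\<close>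
  define F where "F l x = exp (- (l * (norm (h (x - b)))\<^sup>2)) * ((norm (h x))\<^sup>2) powr (- d)" for l x
  define E where "E l z = exp (- (l * (norm (g (z - c)))\<^sup>2))" for l z
  define B where "B l = l powr (m - 1) * exp (- (l * S))" for l :: real
  have nn: "F l x \<ge> 0" "E l z \<ge> 0" "B l \<ge> 0" for l x z
    by (auto simp: F_def E_def B_def)
  have [measurable]: "(\<lambda>(l, x). F l x) \<in> borel_measurable (borel \<Otimes>\<^sub>M borel)"
    "(\<lambda>(l, x). E l x) \<in> borel_measurable (borel \<Otimes>\<^sub>M borel)"
    "B \<in> borel_measurable borel"
    unfolding F_def E_def B_def by measurable
  have [measurable]: "F l \<in> borel_measurable borel" "E l \<in> borel_measurable borel" for l
    unfolding F_def E_def by measurable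
  have E: "(\<integral>\<^sup>+z. ennreal (E l z) \<partial>lborel) = ennreal (l powr (- real DIM('c) / 2)) * ?A" if "l > 0" for l
    using nn_integral_gaussian_tilted[OF g that order_refl, of c] by (simp add: E_def)
  have F: "ennreal (Gamma d) * (\<integral>\<^sup>+x. ennreal (F l x) \<partial>lborel) = ennreal (l powr (d - D / 2)) * ?K *
      (\<integral>\<^sup>+v\<in>{0<..}. ennreal (v powr (d - 1) * (1 + v) powr (- D / 2)
          * exp (- (l * (v / (1 + v) * (norm (h b))\<^sup>2)))) \<partial>lborel)" if "l > 0" for l
    using nn_integral_gaussian_power[OF h that d, of b] by (simp add: F_def D_def)
  have "ennreal (Gamma m * Gamma d) * (\<integral>\<^sup>+z. \<integral>\<^sup>+x. ennreal (
        ((norm (g (z - c)))\<^sup>2 + S + (norm (h (x - b)))\<^sup>2) powr (- m) * ((norm (h x))\<^sup>2) powr (- d)) \<partial>lborel \<partial>lborel)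
    = ennreal (Gamma d) * (\<integral>\<^sup>+z. \<integral>\<^sup>+x. ennreal (Gamma m) * ennreal (
        ((norm (g (z - c)))\<^sup>2 + S + (norm (h (x - b)))\<^sup>2) powr (- m) * ((norm (h x))\<^sup>2) powr (- d)) \<partial>lborel \<partial>lborel)"
    using m d Gamma_real_pos[of m] Gamma_real_pos[of d]
    by (simp add: nn_integral_cmult ennreal_mult mult_ac)
  also have "(\<integral>\<^sup>+z. \<integral>\<^sup>+x. ennreal (Gamma m) * ennreal (
        ((norm (g (z - c)))\<^sup>2 + S + (norm (h (x - b)))\<^sup>2) powr (- m) * ((norm (h x))\<^sup>2) powr (- d)) \<partial>lborel \<partial>lborel)
    = (\<integral>\<^sup>+z. \<integral>\<^sup>+x. \<integral>\<^sup>+l. ennreal (B l * E l z * F l x) * indicator {0<..} l \<partial>lborel \<partial>lborel \<partial>lborel)"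
  proof (intro nn_integral_cong)
    fix z x
    let ?Q = "(norm (g (z - c)))\<^sup>2 + S + (norm (h (x - b)))\<^sup>2"
    have Q: "?Q > 0" using S by (simp add: add_nonneg_pos add_pos_nonneg)
    have "ennreal (Gamma m) * ennreal (?Q powr (- m) * ((norm (h x))\<^sup>2) powr (- d))
      = ennreal (((norm (h x))\<^sup>2) powr (- d)) * ennreal (Gamma m * ?Q powr (- m))"
      using m Gamma_real_pos[of m] by (simp add: ennreal_mult[symmetric] mult_ac)
    also have "\<dots> = (\<integral>\<^sup>+l. ennreal (((norm (h x))\<^sup>2) powr (- d)) *
        (ennreal (l powr (m - 1) * exp (- (l * ?Q))) * indicator {0<..} l) \<partial>lborel)"
      unfolding nn_integral_Gamma[OF m Q, symmetric] by (subst nn_integral_cmult) auto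
    also have "\<dots> = (\<integral>\<^sup>+l. ennreal (B l * E l z * F l x) * indicator {0<..} l \<partial>lborel)"
      by (intro nn_integral_cong)
         (auto simp: indicator_def ennreal_mult[symmetric] B_def E_def F_def distrib_left exp_diff exp_add exp_minus field_simps)
    finally show "ennreal (Gamma m) * ennreal (?Q powr (- m) * ((norm (h x))\<^sup>2) powr (- d))
      = (\<integral>\<^sup>+l. ennreal (B l * E l z * F l x) * indicator {0<..} l \<partial>lborel)" .
  qed
  \<comment> \<open>Two exchanges, first with \<open>x\<close> and then with \<open>z\<close>, bring
    \<open>l\<close> outermost.\<close>
  also have "\<dots> = (\<integral>\<^sup>+z. \<integral>\<^sup>+l. \<integral>\<^sup>+x. ennreal (B l * E l z * F l x) * indicator {0<..} l \<partial>lborel \<partial>lborel \<partial>lborel)"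
    by (intro nn_integral_cong lborel_pair.Fubini') measurable
  also have "\<dots> = (\<integral>\<^sup>+l. \<integral>\<^sup>+z. \<integral>\<^sup>+x. ennreal (B l * E l z * F l x) * indicator {0<..} l \<partial>lborel \<partial>lborel \<partial>lborel)"
    by (rule lborel_pair.Fubini') measurable
  also have "\<dots> = (\<integral>\<^sup>+l\<in>{0<..}. ennreal (B l) * (\<integral>\<^sup>+z. ennreal (E l z) \<partial>lborel) * (\<integral>\<^sup>+x. ennreal (F l x) \<partial>lborel) \<partial>lborel)"
    by (intro nn_integral_cong)
       (simp add: nn ennreal_mult nn_integral_cmult nn_integral_multc mult_ac)
  \<comment> \<open>\<open>Gamma d\<close> goes under the integral because \<open>F\<close> is known
    only in product with it.\<close>
  also have "ennreal (Gamma d) * \<dots> = (\<integral>\<^sup>+l. ennreal (Gamma d) * (ennreal (B l) * (\<integral>\<^sup>+z. ennreal (E l z) \<partial>lborel) * (\<integral>\<^sup>+x. ennreal (F l x) \<partial>lborel) * indicator {0<..} l) \<partial>lborel)"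
    by (subst nn_integral_cmult) auto
  also have "\<dots> = (\<integral>\<^sup>+l. (?A * ?K) * (\<integral>\<^sup>+v. ennreal (v powr (d - 1) * (1 + v) powr (- D / 2)
       * (l powr (q - 1) * exp (- (l * (S + v / (1 + v) * (norm (h b))\<^sup>2))))) * indicator {0<..} v * indicator {0<..} l \<partial>lborel) \<partial>lborel)"
  proof (intro nn_integral_cong)
    fix l :: real
    let ?V = "\<integral>\<^sup>+v\<in>{0<..}. ennreal (v powr (d - 1) * (1 + v) powr (- D / 2)
          * exp (- (l * (v / (1 + v) * (norm (h b))\<^sup>2)))) \<partial>lborel"
    show "ennreal (Gamma d) * (ennreal (B l) * (\<integral>\<^sup>+z. ennreal (E l z) \<partial>lborel) * (\<integral>\<^sup>+x. ennreal (F l x) \<partial>lborel) * indicator {0<..} l)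
      = (?A * ?K) * (\<integral>\<^sup>+v. ennreal (v powr (d - 1) * (1 + v) powr (- D / 2)
       * (l powr (q - 1) * exp (- (l * (S + v / (1 + v) * (norm (h b))\<^sup>2))))) * indicator {0<..} v * indicator {0<..} l \<partial>lborel)"
    proof (cases "l > 0")
      case True
      have p: "l powr (q - 1) = l powr (m - 1) * (l powr (- real DIM('c) / 2) * l powr (d - D / 2))"
        using True by (simp add: powr_add[symmetric] q_def algebra_simps)
      have "ennreal (Gamma d) * (ennreal (B l) * (\<integral>\<^sup>+z. ennreal (E l z) \<partial>lborel) * (\<integral>\<^sup>+x. ennreal (F l x) \<partial>lborel))
        = ennreal (B l) * (\<integral>\<^sup>+z. ennreal (E l z) \<partial>lborel) * (ennreal (Gamma d) * (\<integral>\<^sup>+x. ennreal (F l x) \<partial>lborel))"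
        by (simp add: mult_ac)
      also have "\<dots> = (?A * ?K) * (ennreal (l powr (q - 1) * exp (- (l * S))) * ?V)"
        unfolding E[OF True] F[OF True] p B_def by (simp add: ennreal_mult mult_ac)
      also have "ennreal (l powr (q - 1) * exp (- (l * S))) * ?V
        = (\<integral>\<^sup>+v. ennreal (l powr (q - 1) * exp (- (l * S))) * (ennreal (v powr (d - 1) * (1 + v) powr (- D / 2)
          * exp (- (l * (v / (1 + v) * (norm (h b))\<^sup>2)))) * indicator {0<..} v) \<partial>lborel)"
        by (subst nn_integral_cmult) auto
      also have "\<dots> = (\<integral>\<^sup>+v. ennreal (v powr (d - 1) * (1 + v) powr (- D / 2)
       * (l powr (q - 1) * exp (- (l * (S + v / (1 + v) * (norm (h b))\<^sup>2))))) * indicator {0<..} v \<partial>lborel)"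
        by (intro nn_integral_cong)
           (auto simp: indicator_def ennreal_mult[symmetric] distrib_left exp_diff exp_minus field_simps)
      finally show ?thesis using True by simp
    qed simp
  qed
  also have "\<dots> = (?A * ?K) * (\<integral>\<^sup>+l. \<integral>\<^sup>+v. ennreal (v powr (d - 1) * (1 + v) powr (- D / 2)
       * (l powr (q - 1) * exp (- (l * (S + v / (1 + v) * (norm (h b))\<^sup>2))))) * indicator {0<..} v * indicator {0<..} l \<partial>lborel \<partial>lborel)"
    by (subst nn_integral_cmult) auto
  \<comment> \<open>Exchanging \<open>l\<close> and \<open>v\<close> makes the inner integral a
    Gamma integral with rate \<open>S + v / (1 + v) * (norm (h b))\<^sup>2\<close>.\<close>
  also have "(\<integral>\<^sup>+l. \<integral>\<^sup>+v. ennreal (v powr (d - 1) * (1 + v) powr (- D / 2)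
       * (l powr (q - 1) * exp (- (l * (S + v / (1 + v) * (norm (h b))\<^sup>2))))) * indicator {0<..} v * indicator {0<..} l \<partial>lborel \<partial>lborel)
     = (\<integral>\<^sup>+v. \<integral>\<^sup>+l. ennreal (v powr (d - 1) * (1 + v) powr (- D / 2)
       * (l powr (q - 1) * exp (- (l * (S + v / (1 + v) * (norm (h b))\<^sup>2))))) * indicator {0<..} v * indicator {0<..} l \<partial>lborel \<partial>lborel)"
    by (rule lborel_pair.Fubini') measurable
  also have "\<dots> = (\<integral>\<^sup>+v. ennreal (Gamma q) * (ennreal (v powr (d - 1) * (1 + v) powr (- D / 2)
          * (S + v / (1 + v) * (norm (h b))\<^sup>2) powr (- q)) * indicator {0<..} v) \<partial>lborel)"
  proof (intro nn_integral_cong)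
    fix v :: real
    show "(\<integral>\<^sup>+l. ennreal (v powr (d - 1) * (1 + v) powr (- D / 2)
       * (l powr (q - 1) * exp (- (l * (S + v / (1 + v) * (norm (h b))\<^sup>2))))) * indicator {0<..} v * indicator {0<..} l \<partial>lborel)
      = ennreal (Gamma q) * (ennreal (v powr (d - 1) * (1 + v) powr (- D / 2)
          * (S + v / (1 + v) * (norm (h b))\<^sup>2) powr (- q)) * indicator {0<..} v)"
    proof (cases "v > 0")
      case True
      have Q: "S + v / (1 + v) * (norm (h b))\<^sup>2 > 0" using True S by (simp add: add_pos_nonneg)
      have "(\<integral>\<^sup>+l. ennreal (v powr (d - 1) * (1 + v) powr (- D / 2)
         * (l powr (q - 1) * exp (- (l * (S + v / (1 + v) * (norm (h b))\<^sup>2))))) * indicator {0<..} l \<partial>lborel)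
        = ennreal (v powr (d - 1) * (1 + v) powr (- D / 2)) * ennreal (Gamma q * (S + v / (1 + v) * (norm (h b))\<^sup>2) powr (- q))"
        unfolding nn_integral_Gamma[OF q Q, symmetric]
        by (subst nn_integral_cmult[symmetric]) (simp_all add: ennreal_mult mult.assoc)
      then show ?thesis
        using True q Gamma_real_pos[of q] by (simp add: ennreal_mult mult_ac)
    qed simp
  qed
  also have "\<dots> = ennreal (Gamma q) * (\<integral>\<^sup>+v\<in>{0<..}. ennreal (v powr (d - 1) * (1 + v) powr (- D / 2)
          * (S + v / (1 + v) * (norm (h b))\<^sup>2) powr (- q)) \<partial>lborel)"
    by (subst nn_integral_cmult) auto
  finally show ?thesis by (simp add: mult.assoc)
qed

text \<open>Under \<open>v = (1 - r) * x / (1 - x)\<close> one has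
  \<open>1 + v = (1 - r * x) / (1 - x)\<close> and
  \<open>S + v / (1 + v) * W = S / (1 - r * x)\<close>. Every factor is then a power of
  \<open>x\<close>, \<open>1 - x\<close> or \<open>1 - r * x\<close>, up to constants.\<close>

lemma nn_integral_euler_substitution:
  fixes d k q S W :: real
  assumes S: "S > 0" and W: "W \<ge> 0"
  defines "r \<equiv> W / (S + W)"
  shows "(\<integral>\<^sup>+v\<in>{0<..}. ennreal (v powr (d - 1) * (1 + v) powr (- k) * (S + v / (1 + v) * W) powr (- q)) \<partial>lborel)
    = ennreal ((1 - r) powr d * S powr (- q))
      * (\<integral>\<^sup>+x\<in>{0<..<1}. ennreal (x powr (d - 1) * (1 - x) powr (k - d - 1) * (1 - r * x) powr (q - k)) \<partial>lborel)"
proof -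
  have r: "0 \<le> r" "r < 1" using S W by (auto simp: r_def field_simps)
  \<comment> \<open>This form of the choice of \<open>r\<close> is what makes the term linear in
    \<open>x\<close> vanish below.\<close>
  have SW: "W = r * (S + W)" using S W by (auto simp: r_def field_simps)
  define g where "g v = v powr (d - 1) * (1 + v) powr (- k) * (S + v / (1 + v) * W) powr (- q)" for v
  have [measurable]: "g \<in> borel_measurable borel" unfolding g_def by measurable
  \<comment> \<open>The substitution is done in two stages: scaling by \<open>1 - r\<close>, then
    the odds map.\<close>
  have "(\<integral>\<^sup>+v\<in>{0<..}. ennreal (g v) \<partial>lborel) = ennreal (1 - r) * (\<integral>\<^sup>+v\<in>{0<..}. ennreal (g ((1 - r) * v)) \<partial>lborel)"
    using r by (intro nn_integral_Ioi_scale) auto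
  also have "\<dots> = ennreal (1 - r) * (\<integral>\<^sup>+x\<in>{0<..<1}. ennreal (g ((1 - r) * (x / (1 - x)))) * ennreal (1 / (1 - x)\<^sup>2) \<partial>lborel)"
    by (subst nn_integral_odds_substitution) auto
  also have "\<dots> = ennreal (1 - r) * (\<integral>\<^sup>+x. ennreal ((1 - r) powr (d - 1) * S powr (- q)) *
      (ennreal (x powr (d - 1) * (1 - x) powr (k - d - 1) * (1 - r * x) powr (q - k)) * indicator {0<..<1} x) \<partial>lborel)"
  proof (rule arg_cong[where f = "(*) (ennreal (1 - r))"], rule nn_integral_cong)
    fix x :: real
    show "ennreal (g ((1 - r) * (x / (1 - x)))) * ennreal (1 / (1 - x)\<^sup>2) * indicator {0<..<1} x
      = ennreal ((1 - r) powr (d - 1) * S powr (- q)) *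
      (ennreal (x powr (d - 1) * (1 - x) powr (k - d - 1) * (1 - r * x) powr (q - k)) * indicator {0<..<1} x)"
    proof (cases "x \<in> {0<..<1}")
      case True
      then have x: "0 < x" "x < 1" by auto
      have rx: "1 - r * x > 0" using r x mult_strict_mono'[of r 1 x 1] by simp
      define v where "v = (1 - r) * (x / (1 - x))"
      have v: "v > 0" using r x by (simp add: v_def)
      have v1: "1 + v = (1 - r * x) / (1 - x)" using x by (simp add: v_def field_simps)
      have vv: "v / (1 + v) = (1 - r) * x / (1 - r * x)"
        unfolding v1 using x by (simp add: v_def)
      have "(S + v / (1 + v) * W) * (1 - r * x) = S * (1 - r * x) + (1 - r) * x * W"
        unfolding vv using rx by (simp add: field_simps)
      also have "\<dots> = S + x * (W - r * (S + W))" by (simp add: algebra_simps)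
      also have "\<dots> = S" using SW by simp
      finally have Sv: "S + v / (1 + v) * W = S / (1 - r * x)" using rx by (simp add: field_simps)
      have p1: "v powr (d - 1) = (1 - r) powr (d - 1) * (x powr (d - 1) * (1 - x) powr (1 - d))"
        unfolding v_def using r x powr_minus_divide[of "1 - x" "d - 1"] by (simp add: powr_mult powr_divide)
      have p2: "(1 + v) powr (- k) = (1 - r * x) powr (- k) * (1 - x) powr k"
        unfolding v1 using rx x by (simp add: powr_divide powr_minus field_simps)
      have p3: "(S / (1 - r * x)) powr (- q) = S powr (- q) * (1 - r * x) powr q"
        using rx S by (simp add: powr_divide powr_minus field_simps)
      \<comment> \<open>The three factors stem from \<open>v powr (d - 1)\<close>, from
        \<open>(1 + v) powr (- k)\<close> and from the derivative of the odds.\<close>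
      have p4: "(1 - x) powr (k - d - 1) = (1 - x) powr (1 - d) * (1 - x) powr k * (1 / (1 - x)\<^sup>2)"
      proof -
        have "1 / (1 - x)\<^sup>2 = (1 - x) powr (-2)" using x by (simp add: powr_minus divide_inverse)
        then show ?thesis using x by (simp add: powr_add[symmetric])
      qed
      have p5: "(1 - r * x) powr (q - k) = (1 - r * x) powr (- k) * (1 - r * x) powr q"
        by (simp add: powr_add[symmetric])
      have "g v * (1 / (1 - x)\<^sup>2) = (1 - r) powr (d - 1) * S powr (- q) *
        (x powr (d - 1) * (1 - x) powr (k - d - 1) * (1 - r * x) powr (q - k))"
        unfolding g_def Sv p1 p2 p3 p4 p5 by (simp only: mult_ac)
      then have "ennreal (g v * (1 / (1 - x)\<^sup>2)) = ennreal ((1 - r) powr (d - 1) * S powr (- q) *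
        (x powr (d - 1) * (1 - x) powr (k - d - 1) * (1 - r * x) powr (q - k)))"
        by (rule arg_cong)
      moreover have "g v \<ge> 0" by (simp add: g_def)
      ultimately show ?thesis
        unfolding v_def[symmetric] using True by (simp add: ennreal_mult del: times_divide_eq_right)
    qed simp
  qed
  also have "\<dots> = ennreal (1 - r) * (ennreal ((1 - r) powr (d - 1) * S powr (- q)) *
      (\<integral>\<^sup>+x\<in>{0<..<1}. ennreal (x powr (d - 1) * (1 - x) powr (k - d - 1) * (1 - r * x) powr (q - k)) \<partial>lborel))"
    by (subst nn_integral_cmult) auto
  also have "\<dots> = ennreal ((1 - r) * (1 - r) powr (d - 1) * S powr (- q)) *
      (\<integral>\<^sup>+x\<in>{0<..<1}. ennreal (x powr (d - 1) * (1 - x) powr (k - d - 1) * (1 - r * x) powr (q - k)) \<partial>lborel)"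
    using r by (simp add: ennreal_mult mult.assoc)
  also have "(1 - r) * (1 - r) powr (d - 1) = (1 - r) powr d"
    using r by (simp add: powr_diff)
  finally show ?thesis unfolding g_def .
qed

section \<open>Least squares and the posterior integrals\<close>

definition least_squares :: "real ^ 'p ^ 'n \<Rightarrow> real ^ 'n \<Rightarrow> real ^ 'p" where
  "least_squares X y = (matrix_inv (transpose X ** X) ** transpose X) *v (y - ybar y *\<^sub>R ones)"

lemma hatm_mult_centered: "hatm X *v (y - ybar y *\<^sub>R ones) = X *v least_squares X y"
  by (simp add: hatm_def least_squares_def matrix_vector_mul_assoc matrix_mul_assoc)

lemma inner_matrix_vector_mult: "(X *v u) \<bullet> w = u \<bullet> (transpose X *v w)" for X :: "real ^ 'p ^ 'n"
  by (metis dot_lmul_matrix inner_commute vector_transpose_matrix)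

text \<open>The Gram matrix has trivial kernel, since a vector it annihilates has an image under
  \<open>X\<close> of norm 0; being square, it is invertible, and multiplying the fitted vector by
  the transpose of \<open>X\<close> reproduces that of the centred response.\<close>

lemma normal_equations:
  fixes X :: "real ^ 'p ^ 'n"
  assumes "inj ((*v) X)"
  shows "transpose X *v (y - ybar y *\<^sub>R ones - X *v least_squares X y) = 0"
proof -
  let ?A = "transpose X ** X"
  have "x = 0" if "?A *v x = 0" for x
  proof -
    have "(X *v x) \<bullet> (X *v x) = 0"
      using that by (simp add: inner_matrix_vector_mult matrix_vector_mul_assoc)
    then have "X *v x = X *v 0" by simp
    then show ?thesis using assms by (blast dest: injD)
  qed
  then have "\<exists>B. B ** ?A = mat 1" by (simp add: matrix_left_invertible_ker)
  \<comment> \<open>\<open>matrix_inv\<close> is defined by choice, so a two-sided inverse must be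
    exhibited before its property can be used.\<close>
  then have "\<exists>B. ?A ** B = mat 1 \<and> B ** ?A = mat 1"
    using matrix_left_right_inverse by blast
  then have "?A ** matrix_inv ?A = mat 1"
    unfolding matrix_inv_def by (metis (mono_tags, lifting) someI_ex)
  then show ?thesis
    by (simp add: matrix_vector_mult_diff_distrib least_squares_def matrix_vector_mul_assoc matrix_mul_assoc)
qed

lemma RSS_eq: "RSS X y = (norm (y - ybar y *\<^sub>R ones - X *v least_squares X y))\<^sup>2"
  by (simp add: RSS_def matrix_vector_mult_diff_rdistrib hatm_mult_centered)

lemma inner_ones: "ones \<bullet> y = (\<Sum>i\<in>UNIV. y $ i)"
  by (simp add: inner_vec_def ones_def)

lemma inner_ones_centered: "ones \<bullet> (y - ybar y *\<^sub>R ones) = 0" for y :: "real ^ 'n"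
  unfolding inner_diff_right inner_scaleR_right
  by (simp add: inner_ones ybar_def) (simp add: ones_def)

lemma inner_ones_design:
  fixes X :: "real ^ 'p ^ 'n"
  assumes "\<And>j. (\<Sum>i\<in>UNIV. X $ i $ j) = 0"
  shows "ones \<bullet> (X *v u) = 0"
proof -
  have "transpose X *v ones = 0"
    using assms by (simp add: vec_eq_iff matrix_vector_mult_def transpose_def ones_def)
  then show ?thesis
    unfolding inner_commute[of ones] inner_matrix_vector_mult by (simp only: inner_zero_right)
qed

text \<open>Pythagoras for three orthogonal pieces: centred columns make \<open>ones\<close>
  orthogonal to the column space, and the normal equations do the same for the residual. The
  intercept term is written as the norm of a linear map so that it fits the role of \<open>g\<close>
  in \<open>nn_integral_two_gaussian_power\<close>.\<close>

lemma norm_residual: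
  fixes X :: "real ^ 'p ^ 'n"
  assumes c: "\<And>j. (\<Sum>i\<in>UNIV. X $ i $ j) = 0" and i: "inj ((*v) X)"
  shows "(norm (y - \<alpha> *\<^sub>R ones - X *v \<beta>))\<^sup>2 =
    (norm (sqrt (real CARD('n)) * (\<alpha> - ybar y)))\<^sup>2 + RSS X y + (norm (X *v (\<beta> - least_squares X y)))\<^sup>2"
proof -
  define v where "v = y - ybar y *\<^sub>R ones"
  define w where "w = v - X *v least_squares X y"
  define u where "u = X *v (\<beta> - least_squares X y)"
  have e: "y - \<alpha> *\<^sub>R ones - X *v \<beta> = ((ybar y - \<alpha>) *\<^sub>R ones + w) - u"
    by (simp add: v_def w_def u_def matrix_vector_mult_diff_distrib algebra_simps)
  have 1: "ones \<bullet> w = 0" "ones \<bullet> u = 0"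
    using inner_ones_centered[of y] inner_ones_design[OF c]
    by (simp_all add: w_def v_def u_def inner_diff_right)
  have "u \<bullet> w = 0"
    unfolding u_def inner_matrix_vector_mult w_def v_def normal_equations[OF i] by simp
  then have 2: "w \<bullet> u = 0" by (simp add: inner_commute)
  have 3: "(ones :: real ^ 'n) \<bullet> ones = real CARD('n)" by (simp add: inner_ones) (simp add: ones_def)
  have "(norm (((ybar y - \<alpha>) *\<^sub>R ones + w) - u))\<^sup>2 = (ybar y - \<alpha>)\<^sup>2 * real CARD('n) + w \<bullet> w + u \<bullet> u"
    unfolding power2_norm_eq_inner using 1 2 3
    by (simp add: inner_diff_left inner_diff_right inner_add_left inner_add_right inner_commute power2_eq_square)
  then show ?thesis unfolding e
    by (simp add: RSS_eq w_def v_def u_def power2_norm_eq_inner[symmetric] power_mult_distrib power2_commute)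
qed

text \<open>Residual and fit are orthogonal, so their squared norms add up to the total. The result
  is exactly the \<open>r\<close> of \<open>nn_integral_euler_substitution\<close>.\<close>

lemma Rsq_eq:
  fixes X :: "real ^ 'p ^ 'n"
  assumes i: "inj ((*v) X)"
  shows "Rsq X y = (norm (X *v least_squares X y))\<^sup>2 / (RSS X y + (norm (X *v least_squares X y))\<^sup>2)"
proof -
  define v where "v = y - ybar y *\<^sub>R ones"
  define u where "u = X *v least_squares X y"
  have "u \<bullet> (v - u) = 0"
    unfolding u_def inner_matrix_vector_mult v_def normal_equations[OF i] by simp
  then have "(norm v)\<^sup>2 = (norm (v - u))\<^sup>2 + (norm u)\<^sup>2"
    unfolding power2_norm_eq_inner by (simp add: inner_diff_left inner_diff_right inner_commute)
  then show ?thesis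
    by (simp add: Rsq_def hatm_mult_centered RSS_eq v_def u_def)
qed

text \<open>Tonelli with \<open>s\<close> innermost, followed by scaling \<open>s\<close> by the
  squared residual norm. The parameter \<open>\<kappa>\<close> treats the normalisation (0) and the
  moment of \<open>1 / s\<close> (1) together.\<close>

lemma nn_integral_posterior:
  fixes f :: "real \<Rightarrow> real" and X :: "real ^ 'p ^ 'n" and \<kappa> :: real
  assumes f[measurable]: "f \<in> borel_measurable borel" and f_nonneg: "\<And>t. t \<ge> 0 \<Longrightarrow> f t \<ge> 0"
    and c: "\<And>j. (\<Sum>i\<in>UNIV. X $ i $ j) = 0" and i: "inj ((*v) X)" and S: "RSS X y > 0"
  defines "m \<equiv> real CARD('n) / 2 + \<kappa>"
  shows "(\<integral>\<^sup>+\<theta>\<in>param_space. ennreal (snd (snd \<theta>) powr (- \<kappa>) * likelihood f X y \<theta> * prior_a a X \<theta>) \<partial>lborel)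
    = (\<integral>\<^sup>+s\<in>{0<..}. ennreal (s powr (- m - 1) * f (1 / s)) \<partial>lborel) *
      (\<integral>\<^sup>+\<alpha>. \<integral>\<^sup>+\<beta>. ennreal (((norm (sqrt (real CARD('n)) * (\<alpha> - ybar y)))\<^sup>2 + RSS X y
          + (norm (X *v (\<beta> - least_squares X y)))\<^sup>2) powr (- m)
        * ((norm (X *v \<beta>))\<^sup>2) powr (- ((real CARD('p) - a) / 2))) \<partial>lborel \<partial>lborel)"
    (is "_ = ?C * _")
proof -
  have [measurable]: "(*v) X \<in> borel_measurable borel"
    by (intro borel_measurable_linear) simp
  define Q where "Q \<alpha> \<beta> = (norm (sqrt (real CARD('n)) * (\<alpha> - ybar y)))\<^sup>2 + RSS X y
          + (norm (X *v (\<beta> - least_squares X y)))\<^sup>2" for \<alpha> \<beta>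
  have Q: "Q \<alpha> \<beta> > 0" for \<alpha> \<beta>
    unfolding Q_def using S by (simp add: add_nonneg_pos add_pos_nonneg)
  define P where "P \<beta> = ((norm (X *v \<beta>))\<^sup>2) powr (- ((real CARD('p) - a) / 2))" for \<beta>
  have [measurable]: "(\<lambda>(x, y). Q x y) \<in> borel_measurable (borel \<Otimes>\<^sub>M borel)" "P \<in> borel_measurable borel"
    unfolding Q_def P_def by measurable
  have [measurable]: "Q x \<in> borel_measurable borel" for x
    unfolding Q_def by measurable
  define L where "L \<alpha> \<beta> s = ennreal (s powr (- m - 1) * f (Q \<alpha> \<beta> / s) * P \<beta>) * indicator {0<..} s" for \<alpha> \<beta> s
  have [measurable]: "(\<lambda>(\<alpha>, \<beta>, s). L \<alpha> \<beta> s) \<in> borel_measurable (borel \<Otimes>\<^sub>M (borel \<Otimes>\<^sub>M borel))"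
    unfolding L_def by measurable
  have [measurable]: "(\<lambda>(\<beta>, s). L \<alpha> \<beta> s) \<in> borel_measurable (borel \<Otimes>\<^sub>M borel)" for \<alpha>
    unfolding L_def by measurable
  have "(\<integral>\<^sup>+\<theta>\<in>param_space. ennreal (snd (snd \<theta>) powr (- \<kappa>) * likelihood f X y \<theta> * prior_a a X \<theta>) \<partial>lborel)
    = (\<integral>\<^sup>+\<theta>. (case \<theta> of (\<alpha>, \<beta>, s) \<Rightarrow> L \<alpha> \<beta> s) \<partial>lborel)"
  proof (rule nn_integral_cong)
    fix \<theta> :: "real \<times> (real ^ 'p) \<times> real"
    obtain \<alpha> \<beta> s where \<theta>: "\<theta> = (\<alpha>, \<beta>, s)" by (cases \<theta>)
    show "ennreal (snd (snd \<theta>) powr (- \<kappa>) * likelihood f X y \<theta> * prior_a a X \<theta>) * indicator param_space \<theta>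
      = (case \<theta> of (\<alpha>, \<beta>, s) \<Rightarrow> L \<alpha> \<beta> s)"
    proof (cases "s > 0")
      case True
      \<comment> \<open>The moment, the likelihood and the prior each contribute one factor.\<close>
      have p: "s powr (- m - 1) = s powr (- \<kappa>) * s powr (- real CARD('n) / 2) * (1 / s)"
      proof -
        have "1 / s = s powr (- 1)" using True by (simp add: powr_minus divide_inverse)
        then show "s powr (- m - 1) = s powr (- \<kappa>) * s powr (- real CARD('n) / 2) * (1 / s)"
          by (simp only: powr_add[symmetric]) (rule arg_cong, simp add: m_def)
      qed
      have e: "(a - real CARD('p)) / 2 = - ((real CARD('p) - a) / 2)" by (simp add: field_simps)
      show ?thesis using True
        by (simp add: \<theta> L_def p e likelihood_def prior_a_def param_space_def norm_residual[OF c i] Q_def P_def mult_ac)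
    qed (simp add: \<theta> L_def param_space_def)
  qed
  also have "\<dots> = (\<integral>\<^sup>+\<theta>. (case \<theta> of (\<alpha>, \<beta>, s) \<Rightarrow> L \<alpha> \<beta> s) \<partial>(lborel \<Otimes>\<^sub>M lborel))"
    by (simp only: lborel_prod)
  also have "\<dots> = (\<integral>\<^sup>+\<alpha>. \<integral>\<^sup>+\<eta>. (case (\<alpha>, \<eta>) of (\<alpha>, \<beta>, s) \<Rightarrow> L \<alpha> \<beta> s) \<partial>lborel \<partial>lborel)"
  proof (rule lborel.nn_integral_fst[symmetric])
    \<comment> \<open>The inner Borel algebra on pairs is unfolded into a product so that
      measurability can be checked componentwise.\<close>
    show "(\<lambda>(\<alpha>, \<beta>, s). L \<alpha> \<beta> s) \<in> borel_measurable (lborel \<Otimes>\<^sub>M lborel)"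
      unfolding measurable_cong_sets[OF sets_pair_measure_cong[OF sets_lborel sets_lborel] refl]
        borel_prod[symmetric, where 'a = "real ^ 'p" and 'b = real] by measurable
  qed
  also have "\<dots> = (\<integral>\<^sup>+\<alpha>. \<integral>\<^sup>+\<eta>. (case \<eta> of (\<beta>, s) \<Rightarrow> L \<alpha> \<beta> s) \<partial>(lborel \<Otimes>\<^sub>M lborel) \<partial>lborel)"
    by (simp add: lborel_prod)
  also have "\<dots> = (\<integral>\<^sup>+\<alpha>. \<integral>\<^sup>+\<beta>. \<integral>\<^sup>+s. L \<alpha> \<beta> s \<partial>lborel \<partial>lborel \<partial>lborel)"
    by (subst lborel.nn_integral_fst[symmetric]) simp_all
  also have "\<dots> = (\<integral>\<^sup>+\<alpha>. \<integral>\<^sup>+\<beta>. ?C * ennreal (Q \<alpha> \<beta> powr (- m) * P \<beta>) \<partial>lborel \<partial>lborel)"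
  proof (intro nn_integral_cong)
    fix \<alpha> \<beta>
    have "(\<integral>\<^sup>+s. L \<alpha> \<beta> s \<partial>lborel)
      = (\<integral>\<^sup>+s. ennreal (P \<beta>) * (ennreal (s powr (- m - 1) * f (Q \<alpha> \<beta> / s)) * indicator {0<..} s) \<partial>lborel)"
      using less_imp_le[OF Q]
      by (intro nn_integral_cong) (auto simp: L_def P_def indicator_def f_nonneg ennreal_mult mult_ac)
    also have "\<dots> = ennreal (P \<beta>) * (ennreal (Q \<alpha> \<beta> powr (- m)) * ?C)"
      by (subst nn_integral_cmult) (simp_all add: nn_integral_inverse_scale_mixture[OF f Q])
    finally show "(\<integral>\<^sup>+s. L \<alpha> \<beta> s \<partial>lborel) = ?C * ennreal (Q \<alpha> \<beta> powr (- m) * P \<beta>)"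
      by (simp add: P_def ennreal_mult mult_ac)
  qed
  also have "\<dots> = ?C * (\<integral>\<^sup>+\<alpha>. \<integral>\<^sup>+\<beta>. ennreal (Q \<alpha> \<beta> powr (- m) * P \<beta>) \<partial>lborel \<partial>lborel)"
    by (simp add: nn_integral_cmult)
  finally show ?thesis unfolding Q_def P_def .
qed

text \<open>Combines the radial constant, the Gaussian integrals and the Euler form. The factors
  \<open>Gamma m\<close>, \<open>Gamma d\<close> and \<open>G\<close> stay on the left so that no
  division occurs before the passage to real numbers.\<close>

lemma set_integral_posterior:
  fixes f :: "real \<Rightarrow> real" and X :: "real ^ 'p ^ 'n" and a \<kappa> :: real
  assumes f[measurable]: "f \<in> borel_measurable borel" and f_nonneg: "\<And>t. t \<ge> 0 \<Longrightarrow> f t \<ge> 0"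
    and c: "\<And>j. (\<Sum>i\<in>UNIV. X $ i $ j) = 0" and i: "inj ((*v) X)" and S: "RSS X y > 0"
    and n: "CARD('n) > CARD('p) + 1" and a: "0 < a" "a < real CARD('p)" and k: "\<kappa> \<ge> 0"
    and M: "(\<integral>\<^sup>+e. ennreal (((norm (e::real ^ 'n))\<^sup>2) powr \<kappa> * f ((norm e)\<^sup>2)) \<partial>lborel) = ennreal M" "M \<ge> 0"
  defines "G \<equiv> enn2real (\<integral>\<^sup>+e. ennreal (exp (- (norm (e::real ^ 'n))\<^sup>2)) \<partial>lborel)"
    and "A \<equiv> enn2real (\<integral>\<^sup>+z. ennreal (exp (- (norm (sqrt (real CARD('n)) * z))\<^sup>2)) \<partial>lborel)"
    and "K \<equiv> enn2real (\<integral>\<^sup>+x. ennreal (exp (- (norm (X *v x))\<^sup>2)) \<partial>lborel)"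
    and "d \<equiv> (real CARD('p) - a) / 2"
    and "m \<equiv> real CARD('n) / 2 + \<kappa>"
    and "q \<equiv> (real CARD('n) - 1 - a) / 2 + \<kappa>"
  shows "Gamma m * Gamma d * G *
      (LINT \<theta>:param_space|lborel. snd (snd \<theta>) powr (- \<kappa>) * likelihood f X y \<theta> * prior_a a X \<theta>)
    = Gamma (real CARD('n) / 2) * M * A * K * Gamma q * ((1 - Rsq X y) powr d * RSS X y powr (- q)) *
      (LBINT x=0..1. x powr (real CARD('p) / 2 - a / 2 - 1) * (1 - x) powr (a / 2 - 1)
         * (1 - Rsq X y * x) powr ((real CARD('n) - real CARD('p) - a - 1) / 2 + \<kappa>))"
    (is "_ * ?I = _ * ?N")
proof -
  let ?F = "\<lambda>\<theta>. snd (snd \<theta>) powr (- \<kappa>) * likelihood f X y \<theta> * prior_a a X \<theta>"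
  let ?W = "(norm (X *v least_squares X y))\<^sup>2"
  have [measurable]: "(*v) X \<in> borel_measurable borel"
    by (intro borel_measurable_linear) simp
  have n_gt: "real CARD('p) + 1 < real CARD('n)" using n by linarith
  have d: "d > 0" and m: "m > 0" and q: "q > 0"
    using a n_gt k by (auto simp: d_def m_def q_def intro!: add_pos_nonneg)
  \<comment> \<open>The exponent count of \<open>nn_integral_two_gaussian_power\<close> with one
    intercept and \<open>CARD('p)\<close> slopes.\<close>
  have q': "q = m - real DIM(real) / 2 + d - real DIM(real ^ 'p) / 2"
    by (simp add: q_def m_def d_def field_simps)
  define C where "C = (\<integral>\<^sup>+s\<in>{0<..}. ennreal (s powr (- m - 1) * f (1 / s)) \<partial>lborel)"
  define J where "J = (\<integral>\<^sup>+\<alpha>. \<integral>\<^sup>+\<beta>. ennreal (((norm (sqrt (real CARD('n)) * (\<alpha> - ybar y)))\<^sup>2 + RSS X y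
          + (norm (X *v (\<beta> - least_squares X y)))\<^sup>2) powr (- m)
        * ((norm (X *v \<beta>))\<^sup>2) powr (- d)) \<partial>lborel \<partial>lborel)"
  define N where "N = (\<integral>\<^sup>+x\<in>{0<..<1}. ennreal (x powr (d - 1) * (1 - x) powr (real CARD('p) / 2 - d - 1)
     * (1 - Rsq X y * x) powr (q - real CARD('p) / 2)) \<partial>lborel)"
  have G: "(\<integral>\<^sup>+e. ennreal (exp (- (norm (e::real ^ 'n))\<^sup>2)) \<partial>lborel) = ennreal G"
    using nn_integral_exp_linear_square[of "\<lambda>e::real ^ 'n. e", OF linear_ident inj_on_id2] by (simp add: G_def)
  have n_lin: "linear (\<lambda>z. sqrt (real CARD('n)) * z)" "inj (\<lambda>z. sqrt (real CARD('n)) * z)"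
    by (auto intro!: linearI injI simp: algebra_simps)
  have A: "(\<integral>\<^sup>+z. ennreal (exp (- (norm (sqrt (real CARD('n)) * z))\<^sup>2)) \<partial>lborel) = ennreal A"
    using nn_integral_exp_linear_square[OF n_lin] by (simp add: A_def)
  have K: "(\<integral>\<^sup>+x. ennreal (exp (- (norm (X *v x))\<^sup>2)) \<partial>lborel) = ennreal K"
    using nn_integral_exp_linear_square[OF matrix_vector_mul_linear i] by (simp add: K_def)
  \<comment> \<open>The only place where the moment \<open>M\<close> of the error enters.\<close>
  have CG: "C * ennreal G = ennreal (Gamma (real CARD('n) / 2) * M)"
    using radial_moment[OF f f_nonneg, of \<kappa>, where 'a = "real ^ 'n"] M Gamma_real_pos[of "real CARD('n) / 2"]
    by (simp add: C_def m_def G ennreal_mult)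
  have "ennreal (Gamma m * Gamma d) * J = ennreal A * ennreal K * ennreal (Gamma q) *
     (\<integral>\<^sup>+v\<in>{0<..}. ennreal (v powr (d - 1) * (1 + v) powr (- real CARD('p) / 2)
          * (RSS X y + v / (1 + v) * ?W) powr (- q)) \<partial>lborel)"
    using nn_integral_two_gaussian_power[OF n_lin(1) matrix_vector_mul_linear i d m S q[unfolded q'],
        of "ybar y" "least_squares X y"]
    unfolding q'[symmetric] J_def A K by simp
  also have "\<dots> = ennreal A * ennreal K * ennreal (Gamma q) * (ennreal ((1 - Rsq X y) powr d * RSS X y powr (- q)) * N)"
    using nn_integral_euler_substitution[OF S, of ?W d "real CARD('p) / 2" q]
    by (simp add: N_def Rsq_eq[OF i])
  finally have J: "ennreal (Gamma m * Gamma d) * J =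
    ennreal A * ennreal K * ennreal (Gamma q) * (ennreal ((1 - Rsq X y) powr d * RSS X y powr (- q)) * N)" .
  have I: "?I = enn2real (C * J)"
  proof -
    have meas: "(\<lambda>\<theta>. indicator param_space \<theta> *\<^sub>R ?F \<theta>) \<in> borel_measurable lborel"
    proof -
      have "(\<lambda>(\<alpha>, \<beta>, s). indicator {0<..} s *\<^sub>R (s powr (- \<kappa>) * (s powr (- real CARD('n) / 2) *
          f ((norm (y - \<alpha> *\<^sub>R ones - X *v \<beta>))\<^sup>2 / s)) * (((norm (X *v \<beta>))\<^sup>2) powr (- (real CARD('p) - a) / 2) * (1 / s))))
        \<in> borel_measurable (borel \<Otimes>\<^sub>M (borel \<Otimes>\<^sub>M borel))"
        by measurable
      also have "(\<lambda>(\<alpha>, \<beta>, s). indicator {0<..} s *\<^sub>R (s powr (- \<kappa>) * (s powr (- real CARD('n) / 2) *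
          f ((norm (y - \<alpha> *\<^sub>R ones - X *v \<beta>))\<^sup>2 / s)) * (((norm (X *v \<beta>))\<^sup>2) powr (- (real CARD('p) - a) / 2) * (1 / s))))
        = (\<lambda>\<theta>. indicator param_space \<theta> *\<^sub>R ?F \<theta>)"
        by (auto simp: fun_eq_iff likelihood_def prior_a_def param_space_def indicator_def)
      finally show ?thesis by (simp add: borel_prod)
    qed
    \<comment> \<open>For nonnegative measurable functions this holds even when the integral
      diverges: the Bochner integral and \<open>enn2real\<close> both give 0 then.\<close>
    have "?I = enn2real (\<integral>\<^sup>+\<theta>. ennreal (indicator param_space \<theta> *\<^sub>R ?F \<theta>) \<partial>lborel)"
      unfolding set_lebesgue_integral_def using meas
      by (rule integral_eq_nn_integral)
        (auto simp: indicator_def likelihood_def prior_a_def param_space_def f_nonneg)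
    also have "(\<integral>\<^sup>+\<theta>. ennreal (indicator param_space \<theta> *\<^sub>R ?F \<theta>) \<partial>lborel) = (\<integral>\<^sup>+\<theta>\<in>param_space. ennreal (?F \<theta>) \<partial>lborel)"
      by (intro nn_integral_cong) (auto simp: indicator_def)
    also have "\<dots> = C * J"
      using nn_integral_posterior[OF f f_nonneg c i S, of \<kappa> a] by (simp add: C_def J_def m_def d_def)
    finally show ?thesis .
  qed
  have N: "?N = enn2real N"
  proof -
    have e: "real CARD('p) / 2 - a / 2 - 1 = d - 1" "a / 2 - 1 = real CARD('p) / 2 - d - 1"
      "(real CARD('n) - real CARD('p) - a - 1) / 2 + \<kappa> = q - real CARD('p) / 2"
      by (simp_all add: d_def q_def field_simps)
    have "?N = (LINT x|lborel. indicator {0<..<1} x *\<^sub>R (x powr (d - 1) * (1 - x) powr (real CARD('p) / 2 - d - 1)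
       * (1 - Rsq X y * x) powr (q - real CARD('p) / 2)))"
      unfolding e by (simp add: interval_lebesgue_integral_def set_lebesgue_integral_def zero_ereal_def one_ereal_def)
    also have "\<dots> = enn2real (\<integral>\<^sup>+x. ennreal (indicator {0<..<1} x *\<^sub>R (x powr (d - 1) * (1 - x) powr (real CARD('p) / 2 - d - 1)
       * (1 - Rsq X y * x) powr (q - real CARD('p) / 2))) \<partial>lborel)"
      by (rule integral_eq_nn_integral) auto
    also have "\<dots> = enn2real N"
      unfolding N_def by (intro arg_cong[where f = enn2real] nn_integral_cong) (auto simp: indicator_def)
    finally show ?thesis .
  qed
  have pos: "Gamma m > 0" "Gamma d > 0" "Gamma q > 0" "G \<ge> 0" "A \<ge> 0" "K \<ge> 0" "Gamma (real CARD('n) / 2) > 0"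
    using d m q by (auto simp: G_def A_def K_def)
  have "ennreal (Gamma m * Gamma d) * ennreal G * (C * J) = (C * ennreal G) * (ennreal (Gamma m * Gamma d) * J)"
    by (simp add: mult_ac)
  also have "\<dots> = ennreal (Gamma (real CARD('n) / 2) * M) * (ennreal A * ennreal K * ennreal (Gamma q) *
      (ennreal ((1 - Rsq X y) powr d * RSS X y powr (- q)) * N))"
    unfolding CG J ..
  \<comment> \<open>\<open>enn2real\<close> is multiplicative also at infinity, so the identity
    descends to the reals without any finiteness of \<open>J\<close> or \<open>N\<close>.\<close>
  finally have "enn2real (ennreal (Gamma m * Gamma d) * ennreal G * (C * J)) = enn2real \<dots>" by simp
  then show ?thesis
    using pos M(2) unfolding I N enn2real_mult by (simp add: mult_ac)
qed

section \<open>The estimator as a quotient of two posterior integrals\<close>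

theorem theorem2p2:
  fixes f :: "real \<Rightarrow> real"
    and X :: "real ^ 'p ^ 'n"
    and y :: "real ^ 'n"
    and a :: real
  assumes f_meas: "f \<in> borel_measurable borel"
    and f_nonneg: "\<And>t. t \<ge> 0 \<Longrightarrow> f t \<ge> 0"
    and f_density: "has_bochner_integral lborel (\<lambda>e::real ^ 'n. f ((norm e) ^ 2)) 1"
    and f_mean: "\<And>i. has_bochner_integral lborel (\<lambda>e::real ^ 'n. e $ i * f ((norm e) ^ 2)) 0"
    and f_var: "\<And>i j. has_bochner_integral lborel
                  (\<lambda>e::real ^ 'n. e $ i * e $ j * f ((norm e) ^ 2)) (if i = j then 1 else 0)"
    and X_centered: "\<And>j. (\<Sum>i\<in>UNIV. X $ i $ j) = 0"
    and X_rank: "rank X = CARD('p)"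
    and n_gt: "CARD('n) > CARD('p) + 1"
    and a_pos: "0 < a" and a_lt: "a < real CARD('p)"
    and RSS_pos: "RSS X y > 0"
  shows "gb_stein f (prior_a a X) X y
           = phi_GB CARD('n) CARD('p) a (Rsq X y) * (RSS X y / (real CARD('n) - real CARD('p) - 1))"
proof -
  let ?n = "real CARD('n)" and ?p = "real CARD('p)" and ?S = "RSS X y" and ?r = "Rsq X y"
  have i: "inj ((*v) X)" using X_rank full_rank_injective by blast
  define G where "G = enn2real (\<integral>\<^sup>+e. ennreal (exp (- (norm (e::real ^ 'n))\<^sup>2)) \<partial>lborel)"
  define A where "A = enn2real (\<integral>\<^sup>+z. ennreal (exp (- (norm (sqrt (real CARD('n)) * z))\<^sup>2)) \<partial>lborel)"
  define K where "K = enn2real (\<integral>\<^sup>+x. ennreal (exp (- (norm (X *v x))\<^sup>2)) \<partial>lborel)"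
  define d where "d = (?p - a) / 2"
  define q where "q = (?n - 1 - a) / 2"
  define I where "I \<kappa> = (LINT \<theta>:param_space|lborel. snd (snd \<theta>) powr (- \<kappa>) * likelihood f X y \<theta> * prior_a a X \<theta>)" for \<kappa>
  define N where "N \<kappa> = (LBINT x=0..1. x powr (?p / 2 - a / 2 - 1) * (1 - x) powr (a / 2 - 1)
         * (1 - ?r * x) powr ((?n - ?p - a - 1) / 2 + \<kappa>))" for \<kappa>
  have n_lin: "linear (\<lambda>z. sqrt (real CARD('n)) * z)" "inj (\<lambda>z. sqrt (real CARD('n)) * z)"
    by (auto intro!: linearI injI simp: algebra_simps)
  have pos: "G > 0" "A > 0" "K > 0"
    using nn_integral_exp_linear_square[of "\<lambda>e::real ^ 'n. e", OF linear_ident inj_on_id2]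
      nn_integral_exp_linear_square[OF n_lin]
      nn_integral_exp_linear_square[OF matrix_vector_mul_linear i]
    by (auto simp: G_def A_def K_def enn2real_positive_iff)
  have q: "q > 0" and d: "d > 0" using a_pos a_lt n_gt by (auto simp: q_def d_def)
  have r: "(1 - ?r) powr d > 0"
    using RSS_pos by (simp add: Rsq_eq[OF i] field_simps add_pos_nonneg)
  have M0: "(\<integral>\<^sup>+e. ennreal (((norm (e::real ^ 'n))\<^sup>2) powr 0 * f ((norm e)\<^sup>2)) \<partial>lborel) = ennreal 1"
  proof -
    have "(\<integral>\<^sup>+e. ennreal (((norm (e::real ^ 'n))\<^sup>2) powr 0 * f ((norm e)\<^sup>2)) \<partial>lborel)
      = (\<integral>\<^sup>+e. ennreal (f ((norm (e::real ^ 'n))\<^sup>2)) \<partial>lborel)"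
      \<comment> \<open>\<open>powr\<close> sends base 0 to 0 even for exponent 0, so the integrands
        may differ at the origin, a null set.\<close>
      by (rule nn_integral_cong_AE, use AE_lborel_singleton[of 0] in eventually_elim) auto
    also have "\<dots> = ennreal 1"
      using f_density f_nonneg by (subst nn_integral_eq_integral) (auto simp: has_bochner_integral_iff)
    finally show ?thesis .
  qed
  have M1: "(\<integral>\<^sup>+e. ennreal (((norm (e::real ^ 'n))\<^sup>2) powr 1 * f ((norm e)\<^sup>2)) \<partial>lborel) = ennreal ?n"
  proof -
    \<comment> \<open>Summing the diagonal second moments gives the trace of the identity
      covariance, which is the sample size.\<close>
    have "has_bochner_integral lborel (\<lambda>e::real ^ 'n. \<Sum>i\<in>UNIV. e $ i * e $ i * f ((norm e)\<^sup>2)) (\<Sum>i\<in>(UNIV::'n set). if i = i then 1 else 0)"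
      by (intro has_bochner_integral_sum f_var)
    moreover have "(\<Sum>i\<in>UNIV. e $ i * e $ i * f ((norm e)\<^sup>2)) = (norm e)\<^sup>2 * f ((norm e)\<^sup>2)" for e :: "real ^ 'n"
      by (simp add: power2_norm_eq_inner inner_vec_def sum_distrib_right)
    ultimately have "has_bochner_integral lborel (\<lambda>e::real ^ 'n. (norm e)\<^sup>2 * f ((norm e)\<^sup>2)) ?n" by simp
    then show ?thesis
      using f_nonneg by (subst nn_integral_eq_integral) (auto simp: has_bochner_integral_iff)
  qed
  note post = set_integral_posterior[OF f_meas f_nonneg X_centered i RSS_pos n_gt a_pos a_lt,
      folded G_def A_def K_def d_def I_def N_def]
  \<comment> \<open>Collects the factors common to \<open>I 0\<close> and \<open>I 1\<close>; only
    its being nonzero matters.\<close>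
  define c where "c = Gamma (?n / 2) * A * K * (1 - ?r) powr d / (Gamma d * G)"
  have c: "c > 0" using pos r d by (simp add: c_def)
  have Gpos: "Gamma d \<noteq> 0" "Gamma q \<noteq> 0" "Gamma (?n / 2) \<noteq> 0" "Gamma (?n / 2 + 1) \<noteq> 0"
    using d q by (auto intro!: less_imp_neq[symmetric] Gamma_real_pos)
  have "Gamma (?n / 2) * Gamma d * G * I 0 =
      Gamma (?n / 2) * A * K * Gamma q * ((1 - ?r) powr d * ?S powr (- q)) * N 0"
    using post[OF _ order_refl M0] by (simp add: q_def)
  then have I0: "I 0 = c * (Gamma q / Gamma (?n / 2)) * ?S powr (- q) * N 0"
    using pos Gpos by (simp add: c_def field_simps)
  have "Gamma (?n / 2 + 1) * Gamma d * G * I 1 =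
      Gamma (?n / 2) * ?n * A * K * Gamma (q + 1) * ((1 - ?r) powr d * ?S powr (- (q + 1))) * N 1"
    using post[OF _ zero_le_one M1] by (simp add: q_def)
  then have I1: "I 1 = c * (Gamma (q + 1) / Gamma (?n / 2 + 1)) * ?S powr (- (q + 1)) * ?n * N 1"
    using pos Gpos by (simp add: c_def field_simps)
  have Gamma_Suc: "Gamma (z + 1) = z * Gamma z" if "z > 0" for z :: real
    using that by (intro Gamma_plus1) (auto dest: nonpos_Ints_nonpos)
  have Gq: "Gamma (q + 1) = q * Gamma q" and Gn: "Gamma (?n / 2 + 1) = ?n / 2 * Gamma (?n / 2)"
    using Gamma_Suc[OF q] Gamma_Suc[of "?n / 2"] by auto
  have Sq: "?S powr (- q) = ?S * ?S powr (- (q + 1))"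
    using RSS_pos by (simp add: powr_diff powr_minus powr_add field_simps)
  have "gb_stein f (prior_a a X) X y = inverse (I 1 / I 0)"
  proof -
    \<comment> \<open>On the parameter space \<open>s\<close> is positive, so its powers with
      exponents -1 and 0 are \<open>1 / s\<close> and 1.\<close>
    have "(LINT \<theta>:param_space|lborel. 1 / snd (snd \<theta>) * likelihood f X y \<theta> * prior_a a X \<theta>) = I 1"
      unfolding I_def set_lebesgue_integral_def
      by (intro Bochner_Integration.integral_cong) (auto simp: indicator_def param_space_def powr_minus divide_inverse)
    moreover have "(LINT \<theta>:param_space|lborel. likelihood f X y \<theta> * prior_a a X \<theta>) = I 0"
      unfolding I_def set_lebesgue_integral_def
      by (intro Bochner_Integration.integral_cong) (auto simp: indicator_def param_space_def)
    ultimately show ?thesis by (simp add: gb_stein_def)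
  qed
  also have "\<dots> = I 0 / I 1" by simp
  \<comment> \<open>The Gamma recursions leave \<open>q\<close> from the exponents and half the
    sample size from the radial constant; the latter cancels against the second moment except for
    the factor 2, giving \<open>2 * q\<close>, which is the denominator \<open>n - a - 1\<close> of
    \<open>phi_GB\<close>.\<close>
  also have "\<dots> = ?S / (2 * q) * (N 0 / N 1)"
    unfolding I0 I1 Gq Gn Sq using c q Gpos RSS_pos by simp
  also have "\<dots> = phi_GB CARD('n) CARD('p) a ?r * (?S / (?n - ?p - 1))"
  proof -
    have N1: "N 1 = (LBINT x=0..1. x powr (?p / 2 - a / 2 - 1) * (1 - x) powr (a / 2 - 1)
         * (1 - ?r * x) powr ((?n - ?p - a + 1) / 2))"
      by (simp add: N_def field_simps)
    have q2: "?n - a - 1 = 2 * q" by (simp add: q_def)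
    have N0: "N 0 = (LBINT x=0..1. x powr (?p / 2 - a / 2 - 1) * (1 - x) powr (a / 2 - 1)
         * (1 - ?r * x) powr ((?n - ?p - a - 1) / 2))"
      by (simp add: N_def)
    have "phi_GB CARD('n) CARD('p) a ?r = (?n - ?p - 1) / (2 * q) * (N 0 / N 1)"
      unfolding phi_GB_def q2 N0 N1 ..
    \<comment> \<open>Lets the degrees of freedom in \<open>phi_GB\<close> cancel against the
      divisor of the residual sum of squares.\<close>
    moreover have "?n - ?p - 1 \<noteq> 0" using n_gt by linarith
    ultimately show ?thesis by (simp add: mult_ac)
  qed
  finally show ?thesis .
qed

end
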